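(* Let $\ell\in\mathbb{N}_0$ denote the level, and let $\mathcal{A}_\ell$ be the affine parameter-dependent operator with blocks $A_\ell(p)=A_\ell^{(0)}+\sum_{\nu=1}^d p^{(\nu)}A_\ell^{(\nu)}$, $p\in\mathcal{I}$, where $A_\ell(p)$ is symmetric positive definite for every $p\in\mathcal{I}$. Let $\mathrm{diag}(A_\ell^{(\mu)})$ and $D_\ell^{(\mu)}$ have only nonnegative entries for all $\mu\in\{0,\dots,d\}$, where $D_\ell^{(0)}=\mathrm{diag}(A_\ell^{(0)})$ and $D_\ell^{(\mu)}=\mathrm{diag}(p^{(\mu)}(1),\dots,p^{(\mu)}(n_\mu))$ for $\mu\ge1$. Let $$\widetilde{\mathcal{D}_\ell}=\sum_{\nu=0}^d\ \bigotimes_{\mu<\nu}\mathrm{Id}_{n_{d-\mu}}\otimes c_{d-\nu}D_\ell^{(d-\nu)}\otimes\bigotimes_{\mu>\nu}\mathrm{Id}_{n_{d-\mu}},$$ where $c_0=1$ and $c_\mu=\max_i A_\ell^{(\mu)}[i,i]\ge0$ for $\mu\in\{1,\dots,d\}$, with spectrum $\sigma(\widetilde{\mathcal{D}_\ell})\subseteq[a,b]$ for some $0<a<b\le\infty$. Let $k\in\mathbb{N}$ and let $\alpha_m,\beta_m>0$ $(m=1,\dots,k)$ be the weights of the exponential sum approximation on $[a,b]$. Then the iteration matrix of the modified approximate damped Jacobi method, given by $$\mathcal{S}_{\mathrm{modJac},k,\omega}:=\mathrm{Id}-\omega\,E_k^*(\widetilde{\mathcal{D}_\ell})\,\mathcal{A}_\ell,$$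 fulfills the smoothing property for any damping parameter $\omega\in(0,\omega_0)$, where $$\omega_0=\frac{1}{\rho\left(E_k^*(\widetilde{\mathcal{D}_\ell})\,\mathcal{A}_\ell\right)}.$$ Here the smoothing property means: with $S_\ell(p)$ the block of $\mathcal{S}_{\mathrm{modJac},k,\omega}$ (at level $\ell$) belonging to $p$, $$\lVert A_\ell(p)S_\ell^\nu(p)\rVert_2\le\eta(\nu)\,\lVert A_\ell(p)\rVert_2$$ for all $0\le\nu\le\overline{\nu}(h_\ell)$, all $p\in\mathcal{I}$ and all levels $\ell\in\mathbb{N}_0$, with functions $\eta$ and $\overline{\nu}$, independent of the level $\ell$, satisfying $\lim_{\nu\to\infty}\eta(\nu)=0$ and ($\lim_{h\to0}\overline{\nu}(h)=\infty$ or $\overline{\nu}(h)=\infty$).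
   Context: The levels $\ell\in\mathbb{N}_0$ correspond to grids with grid sizes $h_\ell>0$. $\mathcal{I}=\mathcal{I}_1\times\dots\times\mathcal{I}_d$ with finite sets of real parameter values $\mathcal{I}_\nu=\{p^{(\nu)}(1),\dots,p^{(\nu)}(n_\nu)\}$; $A_\ell^{(0)},\dots,A_\ell^{(d)}$ are parameter-independent square matrices of common size $n_0\times n_0$ (the number $n_0$ of unknowns depends on the level). The operator $$\mathcal{A}_\ell=\mathrm{Id}_{n_d}\otimes\dots\otimes\mathrm{Id}_{n_1}\otimes A_\ell^{(0)}+\sum_{\nu=1}^d \mathrm{Id}_{n_d}\otimes\dots\otimes\mathrm{diag}\left(p^{(\nu)}(1),\dots,p^{(\nu)}(n_\nu)\right)\otimes\dots\otimes\mathrm{Id}_{n_1}\otimes A_\ell^{(\nu)}$$ (with the diagonal matrix in the position of $\mathrm{Id}_{n_\nu}$) is block diagonal with diagonal blocks $A_\ell(p)$, $p\in\mathcal{I}$; $\widetilde{\mathcal{D}_\ell}$ acts on the same space. $\mathrm{diag}(\cdot)$ of a matrix is its diagonal part, $\sigma(\cdot)$ the spectrum, $\rho(\cdot)$ the spectral radius, $\lVert\cdot\rVert_2$ the spectral norm. If $b=\infty$, $[a,b]$ means $[a,\infty)$. Exponential sums: for $R=b/a\in(1,\infty]$ let $\alpha_{m,[1,R]},\beta_{m,[1,R]}>0$, $m=1,\dots,k$, be weights for which $x\mapsto\sum_{m=1}^k\alpha_{m,[1,R]}\exp(-\beta_{m,[1,R]}x)$ minimizes $\sup_{x\in[1,R]}\left|\frac1x-E_k(x)\right|$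 among all exponential sums $E_k(x)=\sum_{m=1}^k\alpha_m\exp(-\beta_m x)$ with positive weights. The weights on $[a,b]$ are $\alpha_m=\alpha_{m,[1,R]}/a$, $\beta_m=\beta_{m,[1,R]}/a$, and for a diagonal matrix $D$, $E_k^*(D)=\sum_{m=1}^k\alpha_m\exp(-\beta_m D)$ (matrix exponential).
   Formalization: For b = ∞ it is additionally assumed that the spectra of D̃_ℓ for all levels ℓ lie in a common bounded interval [a,B]; without this the claim fails, e.g. for A_ℓ^(0) = diag(1,ℓ+1), A_ℓ^(1) = 0, h_ℓ = 1/(ℓ+1). *)

theory Defs
  imports
    "HOL-Library.Extended_Real"
    "HOL-Library.FuncSet"
    "Jordan_Normal_Form.Spectral_Radius"
begin

text \<open>Matrices whose sizes vary with the level are rendered by the carrier-based matrices of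
  \<^theory>\<open>Jordan_Normal_Form.Matrix\<close>. All indices of matrices, and hence also of parameter values,
  start from 0.\<close>

section \<open>General matrix notions\<close>

definition kron :: "'a::semiring_0 mat \<Rightarrow> 'a mat \<Rightarrow> 'a mat"  (infixr \<open>\<otimes>\<^sub>K\<close> 70) where
  "A \<otimes>\<^sub>K B = mat (dim_row A * dim_row B) (dim_col A * dim_col B)
     (\<lambda>(i, j). A $$ (i div dim_row B, j div dim_col B) * B $$ (i mod dim_row B, j mod dim_col B))"

text \<open>\<open>tensor d F\<close> is \<open>F d \<otimes> \<dots> \<otimes> F 1 \<otimes> F 0\<close>: the factor with the largest index comes first.\<close>

definition tensor :: "nat \<Rightarrow> (nat \<Rightarrow> 'a::semiring_1 mat) \<Rightarrow> 'a mat" where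
  "tensor d F = foldr (\<lambda>\<mu> M. F \<mu> \<otimes>\<^sub>K M) (rev [0..<Suc d]) (1\<^sub>m 1)"

definition msum :: "nat \<Rightarrow> (nat \<Rightarrow> 'a::monoid_add mat) \<Rightarrow> nat list \<Rightarrow> 'a mat" where
  "msum N F is = foldr (\<lambda>i M. F i + M) is (0\<^sub>m N N)"

definition diag_part :: "'a::zero mat \<Rightarrow> 'a mat" where
  "diag_part A = mat_diag (dim_row A) (\<lambda>i. A $$ (i, i))"

definition nonneg_entries :: "real mat \<Rightarrow> bool" where
  "nonneg_entries A \<longleftrightarrow> (\<forall>i<dim_row A. \<forall>j<dim_col A. 0 \<le> A $$ (i, j))"

definition spd :: "real mat \<Rightarrow> bool" where
  "spd A \<longleftrightarrow> square_mat A \<and> transpose_mat A = A \<and>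
     (\<forall>x\<in>carrier_vec (dim_row A). x \<noteq> 0\<^sub>v (dim_row A) \<longrightarrow> 0 < x \<bullet> (A *\<^sub>v x))"

definition norm2_vec :: "real vec \<Rightarrow> real" where
  "norm2_vec x = sqrt (x \<bullet> x)"

text \<open>The spectral norm is the operator norm induced by the Euclidean norm.\<close>

definition norm2_mat :: "real mat \<Rightarrow> real" where
  "norm2_mat A = Sup {norm2_vec (A *\<^sub>v x) | x. x \<in> carrier_vec (dim_col A) \<and> norm2_vec x \<le> 1}"

text \<open>Spectrum and spectral radius of a real matrix refer to all its complex eigenvalues.\<close>

definition cspectrum :: "real mat \<Rightarrow> complex set" where
  "cspectrum A = spectrum (map_mat complex_of_real A)"

definition rho :: "real mat \<Rightarrow> real" where
  "rho A = spectral_radius (map_mat complex_of_real A)"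

definition mat_exp :: "real mat \<Rightarrow> real mat" where
  "mat_exp A = mat (dim_row A) (dim_col A) (\<lambda>ij. \<Sum>r. (A ^\<^sub>m r) $$ ij / fact r)"


section \<open>The parameter-dependent operator\<close>

text \<open>Throughout, \<open>d\<close> is the number of parameters, \<open>p \<nu> i\<close> with \<open>1 \<le> \<nu> \<le> d\<close> and \<open>i < n \<nu>\<close> is
  the parameter value \<open>p\<^sup>(\<^sup>\<nu>\<^sup>)(i + 1)\<close>, and \<open>A \<mu>\<close> with \<open>\<mu> \<le> d\<close> is the matrix \<open>A\<^sup>(\<^sup>\<mu>\<^sup>)\<close> at some level.
  The number of unknowns \<open>n\<^sub>0\<close> is read off from \<open>A 0\<close>; \<open>n 0\<close> is not used.\<close>

definition msize :: "(nat \<Rightarrow> nat) \<Rightarrow> (nat \<Rightarrow> real mat) \<Rightarrow> nat \<Rightarrow> nat" where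
  "msize n A \<mu> = (if \<mu> = 0 then dim_row (A 0) else n \<mu>)"

definition total_size :: "nat \<Rightarrow> (nat \<Rightarrow> nat) \<Rightarrow> (nat \<Rightarrow> real mat) \<Rightarrow> nat" where
  "total_size d n A = (\<Prod>\<mu>\<le>d. msize n A \<mu>)"

definition param_op :: "nat \<Rightarrow> (nat \<Rightarrow> nat) \<Rightarrow> (nat \<Rightarrow> nat \<Rightarrow> real) \<Rightarrow> (nat \<Rightarrow> real mat) \<Rightarrow> real mat" where
  "param_op d n p A = msum (total_size d n A)
     (\<lambda>\<nu>. tensor d (\<lambda>\<mu>. if \<mu> = 0 then A \<nu>
                         else if \<mu> = \<nu> then mat_diag (n \<nu>) (p \<nu>)
                         else 1\<^sub>m (n \<mu>)))
     [0..<Suc d]"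

text \<open>A parameter tuple is addressed by the multi-index \<open>j\<close> of its components,
  so the parameter set \<open>\<I>\<close> is the set of all \<open>\<lambda>\<nu>. p \<nu> (j \<nu>)\<close> for multi-indices \<open>j\<close>.\<close>

definition multi_indices :: "nat \<Rightarrow> (nat \<Rightarrow> nat) \<Rightarrow> (nat \<Rightarrow> nat) set" where
  "multi_indices d n = (\<Pi>\<^sub>E \<nu>\<in>{1..d}. {..<n \<nu>})"

definition A_param :: "nat \<Rightarrow> (nat \<Rightarrow> real mat) \<Rightarrow> (nat \<Rightarrow> real) \<Rightarrow> real mat" where
  "A_param d A q = A 0 + msum (dim_row (A 0)) (\<lambda>\<nu>. q \<nu> \<cdot>\<^sub>m A \<nu>) [1..<Suc d]"

text \<open>The diagonal block, of size \<open>n0 \<times> n0\<close>, of a matrix on the tensor product space that belongs to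
  the multi-index \<open>j\<close>; its position is determined by the order of factors in \<open>tensor\<close>.\<close>

definition block :: "nat \<Rightarrow> (nat \<Rightarrow> nat) \<Rightarrow> nat \<Rightarrow> real mat \<Rightarrow> (nat \<Rightarrow> nat) \<Rightarrow> real mat" where
  "block d n n0 M j =
     (let q = (\<Sum>\<nu>=1..d. j \<nu> * (\<Prod>\<mu>=1..<\<nu>. n \<mu>))
      in mat n0 n0 (\<lambda>(r, s). M $$ (q * n0 + r, q * n0 + s)))"


section \<open>The diagonal operator\<close>

definition D_mat :: "(nat \<Rightarrow> nat) \<Rightarrow> (nat \<Rightarrow> nat \<Rightarrow> real) \<Rightarrow> (nat \<Rightarrow> real mat) \<Rightarrow> nat \<Rightarrow> real mat" where
  "D_mat n p A \<mu> = (if \<mu> = 0 then diag_part (A 0) else mat_diag (n \<mu>) (p \<mu>))"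

definition c_max :: "(nat \<Rightarrow> real mat) \<Rightarrow> nat \<Rightarrow> real" where
  "c_max A \<mu> = (if \<mu> = 0 then 1 else Max ((\<lambda>i. A \<mu> $$ (i, i)) ` {..<dim_row (A \<mu>)}))"

definition D_tilde :: "nat \<Rightarrow> (nat \<Rightarrow> nat) \<Rightarrow> (nat \<Rightarrow> nat \<Rightarrow> real) \<Rightarrow> (nat \<Rightarrow> real mat) \<Rightarrow> real mat" where
  "D_tilde d n p A = msum (total_size d n A)
     (\<lambda>\<nu>. tensor d (\<lambda>\<mu>. if \<mu> = \<nu> then c_max A \<nu> \<cdot>\<^sub>m D_mat n p A \<nu> else 1\<^sub>m (msize n A \<mu>)))
     [0..<Suc d]"


section \<open>Exponential sums\<close>

text \<open>The interval \<open>[a, b]\<close>, meaning \<open>[a, \<infinity>)\<close> if \<open>b = \<infinity>\<close>.\<close>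

definition ivl :: "real \<Rightarrow> ereal \<Rightarrow> real set" where
  "ivl a b = {x. a \<le> x \<and> ereal x \<le> b}"

definition exp_sum :: "nat \<Rightarrow> (nat \<Rightarrow> real) \<Rightarrow> (nat \<Rightarrow> real) \<Rightarrow> real \<Rightarrow> real" where
  "exp_sum k \<alpha> \<beta> x = (\<Sum>m=1..k. \<alpha> m * exp (- \<beta> m * x))"

text \<open>For positive weights the supremum is over a bounded set, also if \<open>R = \<infinity>\<close>.\<close>

definition exp_sum_error :: "ereal \<Rightarrow> nat \<Rightarrow> (nat \<Rightarrow> real) \<Rightarrow> (nat \<Rightarrow> real) \<Rightarrow> real" where
  "exp_sum_error R k \<alpha> \<beta> = (SUP x\<in>ivl 1 R. \<bar>1 / x - exp_sum k \<alpha> \<beta> x\<bar>)"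

definition positive_weights :: "nat \<Rightarrow> (nat \<Rightarrow> real) \<Rightarrow> (nat \<Rightarrow> real) \<Rightarrow> bool" where
  "positive_weights k \<alpha> \<beta> \<longleftrightarrow> (\<forall>m\<in>{1..k}. 0 < \<alpha> m \<and> 0 < \<beta> m)"

definition best_weights :: "ereal \<Rightarrow> nat \<Rightarrow> (nat \<Rightarrow> real) \<Rightarrow> (nat \<Rightarrow> real) \<Rightarrow> bool" where
  "best_weights R k \<alpha> \<beta> \<longleftrightarrow> positive_weights k \<alpha> \<beta> \<and>
     (\<forall>\<alpha>' \<beta>'. positive_weights k \<alpha>' \<beta>' \<longrightarrow> exp_sum_error R k \<alpha> \<beta> \<le> exp_sum_error R k \<alpha>' \<beta>')"

definition exp_sum_mat :: "nat \<Rightarrow> (nat \<Rightarrow> real) \<Rightarrow> (nat \<Rightarrow> real) \<Rightarrow> real mat \<Rightarrow> real mat" where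
  "exp_sum_mat k \<alpha> \<beta> D = msum (dim_row D) (\<lambda>m. \<alpha> m \<cdot>\<^sub>m mat_exp ((- \<beta> m) \<cdot>\<^sub>m D)) [1..<Suc k]"

text \<open>\<open>E\<^sub>k\<^sup>*(D)\<close> for the interval \<open>[a, b]\<close>, where \<open>\<alpha>\<close> and \<open>\<beta>\<close> are the weights on \<open>[1, b / a]\<close>.\<close>

definition E_star :: "real \<Rightarrow> nat \<Rightarrow> (nat \<Rightarrow> real) \<Rightarrow> (nat \<Rightarrow> real) \<Rightarrow> real mat \<Rightarrow> real mat" where
  "E_star a k \<alpha> \<beta> D = exp_sum_mat k (\<lambda>m. \<alpha> m / a) (\<lambda>m. \<beta> m / a) D"


section \<open>Smoother and smoothing property\<close>

definition mod_jac :: "real \<Rightarrow> real mat \<Rightarrow> real mat \<Rightarrow> real mat" where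
  "mod_jac \<omega> E \<A> = 1\<^sub>m (dim_row \<A>) - \<omega> \<cdot>\<^sub>m (E * \<A>)"

text \<open>\<open>h\<close> maps a level to its grid size; \<open>A l j\<close> and \<open>S l j\<close> are the blocks at level \<open>l\<close>
  belonging to \<open>j \<in> J\<close>. Only values of \<open>\<nu>bar\<close> at positive arguments are relevant.\<close>

definition smoothing_property ::
  "(nat \<Rightarrow> real) \<Rightarrow> 'j set \<Rightarrow> (nat \<Rightarrow> 'j \<Rightarrow> real mat) \<Rightarrow> (nat \<Rightarrow> 'j \<Rightarrow> real mat) \<Rightarrow> bool" where
  "smoothing_property h J A S \<longleftrightarrow>
     (\<exists>(\<eta> :: nat \<Rightarrow> real) (\<nu>bar :: real \<Rightarrow> ereal).
        \<eta> \<longlonglongrightarrow> 0 \<and>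
        ((\<nu>bar \<longlongrightarrow> \<infinity>) (at_right 0) \<or> (\<forall>x>0. \<nu>bar x = \<infinity>)) \<and>
        (\<forall>l. \<forall>j\<in>J. \<forall>\<nu>::nat. ereal (real \<nu>) \<le> \<nu>bar (h l) \<longrightarrow>
           norm2_mat (A l j * (S l j ^\<^sub>m \<nu>)) \<le> \<eta> \<nu> * norm2_mat (A l j)))"

end

theory Submission
  imports Defs "HOL-Analysis.L2_Norm"
begin

text \<open>Write \<open>E\<close> and \<open>A\<close> for the diagonal blocks of \<open>E\<^sub>k\<^sup>*(D)\<close> and of the operator that belong to a
  parameter. Since the spectrum of \<open>D\<close> lies in a compact interval \<open>[a, B]\<close> for all levels, the entries
  of the diagonal matrix \<open>E\<close> are bounded below by a level independent \<open>\<epsilon> > 0\<close>. The symmetric matrix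
  \<open>Y = \<omega> E\<^sup>1\<^sup>/\<^sup>2 A E\<^sup>1\<^sup>/\<^sup>2\<close> is similar to \<open>\<omega> E A\<close>, whose powers stay bounded because
  \<open>\<omega> \<rho> < 1\<close>. For a symmetric matrix, \<open>\<parallel>Y\<^sup>k x\<parallel>\<close> is log-convex in \<open>k\<close>, so bounded powers force
  \<open>\<parallel>Y x\<parallel> \<le> \<parallel>x\<parallel>\<close>. Then \<open>0 \<le> Y\<^sup>2 \<le> Y\<close>, and telescoping
  \<open>\<parallel>Y (1 - Y)\<^sup>m x\<parallel>\<^sup>2 \<le> \<parallel>(1 - Y)\<^sup>m x\<parallel>\<^sup>2 - \<parallel>(1 - Y)\<^sup>m\<^sup>+\<^sup>1 x\<parallel>\<^sup>2\<close> over \<open>m \<le> \<nu>\<close> yields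
  \<open>\<parallel>Y (1 - Y)\<^sup>\<nu> x\<parallel> \<le> \<parallel>x\<parallel> / \<surd>(\<nu> + 1)\<close>. Undoing the similarity,
  \<open>\<parallel>A S\<^sup>\<nu>\<parallel> \<le> 1 / (\<omega> \<epsilon> \<surd>(\<nu> + 1))\<close>. Finally \<open>\<parallel>A\<parallel>\<close> dominates each of the \<open>d + 1\<close> summands of
  a diagonal entry of \<open>D\<close>, so that \<open>a \<le> (d + 1) \<parallel>A\<parallel>\<close>.\<close>

section \<open>Smoothing by a symmetric contraction\<close>

lemma norm2_vec_eq_L2_set: "norm2_vec x = L2_set (\<lambda>i. x $ i) {0..<dim_vec x}"
  by (simp add: norm2_vec_def L2_set_def scalar_prod_def power2_eq_square)

lemma norm2_vec_nonneg [simp]: "0 \<le> norm2_vec x"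
  by (simp add: norm2_vec_eq_L2_set)

lemma scalar_prod_self: "x \<bullet> x = (norm2_vec x)\<^sup>2" for x :: "real vec"
  by (simp add: norm2_vec_def scalar_prod_def sum_nonneg)

lemma scalar_prod_le_norm2_vec:
  assumes "dim_vec x = dim_vec y"
  shows "x \<bullet> y \<le> norm2_vec x * norm2_vec y"
proof -
  have "x \<bullet> y \<le> (\<Sum>i = 0..<dim_vec y. \<bar>x $ i\<bar> * \<bar>y $ i\<bar>)"
    unfolding scalar_prod_def by (intro sum_mono) (simp add: abs_mult[symmetric])
  also have "\<dots> \<le> norm2_vec x * norm2_vec y"
    unfolding norm2_vec_eq_L2_set assms by (rule L2_set_mult_ineq)
  finally show ?thesis .
qed

lemma abs_index_le_norm2_vec: "i < dim_vec x \<Longrightarrow> \<bar>x $ i\<bar> \<le> norm2_vec x"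
  using member_le_L2_set[of "{0..<dim_vec x}" i "\<lambda>i. \<bar>x $ i\<bar>"]
  by (simp add: norm2_vec_eq_L2_set L2_set_def)

lemma norm2_vec_smult: "norm2_vec (c \<cdot>\<^sub>v x) = \<bar>c\<bar> * norm2_vec x"
  by (simp add: norm2_vec_def real_sqrt_mult flip: mult.assoc)

lemma smult_mat_mult_vec:
  fixes M :: "'a::comm_semiring_0 mat"
  assumes "M \<in> carrier_mat nr nc" "x \<in> carrier_vec nc"
  shows "(c \<cdot>\<^sub>m M) *\<^sub>v x = c \<cdot>\<^sub>v (M *\<^sub>v x)"
  using assms by (intro eq_vecI) (auto simp: scalar_prod_def sum_distrib_left mult.assoc)

lemma transpose_smult_mat: "transpose_mat (c \<cdot>\<^sub>m M) = c \<cdot>\<^sub>m transpose_mat M"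
  by (intro eq_matI) auto

text \<open>Each of the n entries of the image is a sum of n products, each at most |c| times the
  norm of x. The modulus avoids a case distinction: \<open>norm_bound M c\<close> admits a negative
  c when n = 0.\<close>

lemma norm2_vec_mult_le:
  assumes M: "M \<in> carrier_mat n n" and c: "norm_bound M c" and x: "x \<in> carrier_vec n"
  shows "norm2_vec (M *\<^sub>v x) \<le> (real n)\<^sup>2 * \<bar>c\<bar> * norm2_vec x"
proof -
  have le: "\<bar>(M *\<^sub>v x) $ i\<bar> \<le> real n * (\<bar>c\<bar> * norm2_vec x)" if i: "i < n" for i
  proof -
    have "\<bar>(M *\<^sub>v x) $ i\<bar> \<le> (\<Sum>j = 0..<n. \<bar>M $$ (i, j) * x $ j\<bar>)"
      using M x i by (simp add: scalar_prod_def)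
    also have "\<dots> \<le> (\<Sum>j = 0..<n. \<bar>c\<bar> * norm2_vec x)"
    proof (rule sum_mono)
      fix j assume j: "j \<in> {0..<n}"
      have "\<bar>M $$ (i, j)\<bar> \<le> \<bar>c\<bar>"
        using c M i j unfolding norm_bound_def by fastforce
      moreover have "\<bar>x $ j\<bar> \<le> norm2_vec x"
        using abs_index_le_norm2_vec x j by auto
      ultimately show "\<bar>M $$ (i, j) * x $ j\<bar> \<le> \<bar>c\<bar> * norm2_vec x"
        by (simp add: abs_mult mult_mono)
    qed
    finally show ?thesis by simp
  qed
  have "norm2_vec (M *\<^sub>v x) \<le> (\<Sum>i = 0..<n. \<bar>(M *\<^sub>v x) $ i\<bar>)"
    using L2_set_le_sum_abs[of "($) (M *\<^sub>v x)" "{0..<n}"] M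
    by (simp add: norm2_vec_eq_L2_set)
  also have "\<dots> \<le> (\<Sum>i = 0..<n. real n * (\<bar>c\<bar> * norm2_vec x))"
    by (intro sum_mono le) simp
  finally show ?thesis by (simp add: power2_eq_square mult.assoc)
qed

lemma norm2_vec_diag_le:
  assumes "x \<in> carrier_vec n" "\<And>i. i < n \<Longrightarrow> \<bar>f i\<bar> \<le> c" "0 \<le> c"
  shows "norm2_vec (mat_diag n f *\<^sub>v x) \<le> c * norm2_vec x"
proof -
  have ent: "(mat_diag n f *\<^sub>v x) $ i = f i * x $ i" if "i < n" for i
  proof -
    have "(mat_diag n f *\<^sub>v x) $ i = (\<Sum>j = 0..<n. (if i = j then f j else 0) * x $ j)"
      using assms(1) that by (simp add: mat_diag_def scalar_prod_def)
    also have "\<dots> = (\<Sum>j = 0..<n. if j = i then f i * x $ i else 0)"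
      by (rule sum.cong) auto
    finally show ?thesis using that by simp
  qed
  have dim: "dim_vec (mat_diag n f *\<^sub>v x) = n" "dim_vec x = n"
    using assms(1) by (auto simp: mat_diag_def)
  have "norm2_vec (mat_diag n f *\<^sub>v x) = L2_set (\<lambda>i. \<bar>f i * x $ i\<bar>) {0..<n}"
    unfolding norm2_vec_eq_L2_set dim by (simp add: L2_set_def ent)
  also have "\<dots> \<le> L2_set (\<lambda>i. c * \<bar>x $ i\<bar>) {0..<n}"
    by (intro L2_set_mono) (auto simp: abs_mult assms mult_right_mono)
  also have "\<dots> = c * norm2_vec x"
    unfolding norm2_vec_eq_L2_set dim L2_set_right_distrib[OF assms(3)]
    by (simp add: L2_set_def power_mult_distrib)
  finally show ?thesis .
qed

text \<open>A real supremum dominates the members of its set only if the set is bounded above; this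
  makes \<open>cSup_upper\<close> applicable to \<open>norm2_mat\<close>.\<close>

lemma norm2_mat_bdd_above:
  assumes M: "M \<in> carrier_mat n n"
  shows "bdd_above {norm2_vec (M *\<^sub>v x) | x. x \<in> carrier_vec (dim_col M) \<and> norm2_vec x \<le> 1}"
proof -
  obtain c where c: "norm_bound M c"
    using norm_bound_max by blast
  have "norm2_vec (M *\<^sub>v x) \<le> (real n)\<^sup>2 * \<bar>c\<bar>"
    if "x \<in> carrier_vec (dim_col M)" "norm2_vec x \<le> 1" for x
  proof -
    have "norm2_vec (M *\<^sub>v x) \<le> (real n)\<^sup>2 * \<bar>c\<bar> * norm2_vec x"
      using M c that by (intro norm2_vec_mult_le) auto
    also have "\<dots> \<le> (real n)\<^sup>2 * \<bar>c\<bar>"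
      using that by (intro mult_left_le) auto
    finally show ?thesis .
  qed
  then show ?thesis by (auto intro!: bdd_aboveI)
qed

text \<open>The i-th unit vector is mapped to the i-th column, whose norm is at least its i-th
  entry. All lower bounds on the norm of A(p) come from here.\<close>

lemma diag_entry_le_norm2_mat:
  assumes M: "M \<in> carrier_mat n n" and i: "i < n"
  shows "M $$ (i, i) \<le> norm2_mat M"
proof -
  have "M *\<^sub>v unit_vec n i = col M i"
    using M i by (intro eq_vecI) auto
  then have "M $$ (i, i) \<le> norm2_vec (M *\<^sub>v unit_vec n i)"
    using abs_index_le_norm2_vec[of i "M *\<^sub>v unit_vec n i"] M i by simp
  also have "\<dots> \<le> norm2_mat M"
    unfolding norm2_mat_def using M i
    by (intro cSup_upper norm2_mat_bdd_above[OF M]) (auto simp: norm2_vec_def intro!: exI[of _ "unit_vec n i"])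
  finally show ?thesis .
qed

lemma norm2_mat_le:
  assumes "M \<in> carrier_mat n n" "0 \<le> c"
    and le: "\<And>x. x \<in> carrier_vec n \<Longrightarrow> norm2_vec (M *\<^sub>v x) \<le> c * norm2_vec x"
  shows "norm2_mat M \<le> c"
  unfolding norm2_mat_def
proof (rule cSup_least)
  show "{norm2_vec (M *\<^sub>v x) | x. x \<in> carrier_vec (dim_col M) \<and> norm2_vec x \<le> 1} \<noteq> {}"
    by (auto intro!: exI[of _ "0\<^sub>v (dim_col M)"] simp: norm2_vec_def)
next
  fix y assume "y \<in> {norm2_vec (M *\<^sub>v x) | x. x \<in> carrier_vec (dim_col M) \<and> norm2_vec x \<le> 1}"
  then obtain x where x: "x \<in> carrier_vec n" "norm2_vec x \<le> 1" "y = norm2_vec (M *\<^sub>v x)"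
    using assms(1) by auto
  then show "y \<le> c"
    using le[of x] mult_left_le[of "norm2_vec x" c] assms(2) by auto
qed

section \<open>Contraction from bounded powers\<close>

lemma log_convex_bounded_imp_le:
  fixes g :: "nat \<Rightarrow> real"
  assumes nonneg: "\<And>k. 0 \<le> g k" and log_convex: "\<And>k. (g (Suc k))\<^sup>2 \<le> g k * g (Suc (Suc k))"
    and bound: "\<And>k. g k \<le> C"
  shows "g 1 \<le> g 0"
proof (rule ccontr)
  assume "\<not> g 1 \<le> g 0"
  then have gt: "g 0 < g 1" by simp
  then have g1: "0 < g 1" using nonneg[of 0] by simp
  \<comment> \<open>If \<open>g 0\<close> vanished, log-convexity at 0 would make \<open>g 1\<close>
    vanish too.\<close>
  have g0: "0 < g 0"
  proof (rule ccontr)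
    assume "\<not> 0 < g 0"
    then have "g 0 = 0" using nonneg[of 0] by simp
    then show False using log_convex[of 0] g1 by simp
  qed
  \<comment> \<open>By log-convexity the ratios of consecutive values do not decrease. All of them
    are at least the first one, r > 1, so g grows geometrically, against its bound.\<close>
  define r where "r = g 1 / g 0"
  have r: "1 < r" using gt g0 by (simp add: r_def)
  \<comment> \<open>Positivity is carried along because the induction step cancels the factor
    \<open>g k\<close>.\<close>
  have step: "0 < g k \<and> r * g k \<le> g (Suc k)" for k
  proof (induction k)
    case 0 then show ?case using g0 by (simp add: r_def)
  next
    case (Suc k)
    then have pos: "0 < g (Suc k)" using r by (smt (verit) mult_pos_pos)
    have "g k * (r * g (Suc k)) \<le> g (Suc k) * g (Suc k)"
      using Suc pos by (simp add: mult.assoc mult.left_commute mult_right_mono flip: mult.assoc)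
    also have "\<dots> \<le> g k * g (Suc (Suc k))"
      using log_convex[of k] by (simp add: power2_eq_square)
    finally show ?case using Suc pos by simp
  qed
  have pow: "r ^ k * g 0 \<le> g k" for k
  proof (induction k)
    case (Suc k)
    have "r ^ Suc k * g 0 \<le> r * g k" using Suc r by simp
    also have "\<dots> \<le> g (Suc k)" using step by blast
    finally show ?case .
  qed simp
  obtain k where "C / g 0 < r ^ k" using real_arch_pow[OF r] by blast
  then have "C < r ^ k * g 0" using g0 by (simp add: divide_less_eq)
  with pow[of k] bound[of k] show False by simp
qed

text \<open>\<open>pow_mat\<close> appends the new factor on the right, whereas the orbit of a
  vector needs it on the left.\<close>

lemma pow_mat_Suc_vec:
  fixes M :: "'a::comm_ring_1 mat"
  assumes M: "M \<in> carrier_mat n n" and x: "x \<in> carrier_vec n"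
  shows "M ^\<^sub>m Suc k *\<^sub>v x = M *\<^sub>v (M ^\<^sub>m k *\<^sub>v x)"
  using x
proof (induction k arbitrary: x)
  case 0 then show ?case using M by simp
next
  case (Suc k)
  have Mk: "M ^\<^sub>m k \<in> carrier_mat n n" using M by simp
  have "M ^\<^sub>m Suc (Suc k) *\<^sub>v x = M ^\<^sub>m Suc k *\<^sub>v (M *\<^sub>v x)"
    unfolding pow_mat.simps(2)[of M "Suc k"]
    using M Suc.prems by (intro assoc_mult_mat_vec) (auto simp del: pow_mat.simps)
  also have "\<dots> = M *\<^sub>v (M ^\<^sub>m k *\<^sub>v (M *\<^sub>v x))"
    using M Suc.prems by (intro Suc.IH) simp
  also have "\<dots> = M *\<^sub>v (M ^\<^sub>m Suc k *\<^sub>v x)"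
    using M Mk Suc.prems by (simp add: assoc_mult_mat_vec[of _ n n _ n])
  finally show ?case .
qed

lemma scalar_prod_symmetric_mat:
  fixes M :: "real mat"
  assumes M: "M \<in> carrier_mat n n" and sym: "transpose_mat M = M"
    and x: "x \<in> carrier_vec n" and y: "y \<in> carrier_vec n"
  shows "(M *\<^sub>v x) \<bullet> y = x \<bullet> (M *\<^sub>v y)"
  using transpose_vec_mult_scalar[OF M x y] sym M x y
  by (metis comm_scalar_prod mult_mat_vec_carrier)

text \<open>By symmetry, |Y^(k+1) x|^2 is the scalar product of Y^k x and Y^(k+2) x, so
  Cauchy-Schwarz makes |Y^k x| log-convex in k. Since c may be arbitrarily large, it can absorb the
  constants of a similarity transformation.\<close>

lemma symmetric_power_bounded_contraction:
  fixes Y :: "real mat"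
  assumes Y: "Y \<in> carrier_mat n n" and sym: "transpose_mat Y = Y"
    and bound: "\<And>k. norm_bound (Y ^\<^sub>m k) c" and x: "x \<in> carrier_vec n"
  shows "norm2_vec (Y *\<^sub>v x) \<le> norm2_vec x"
proof -
  define z where "z k = Y ^\<^sub>m k *\<^sub>v x" for k
  have Yk: "Y ^\<^sub>m k \<in> carrier_mat n n" for k using Y by simp
  have z: "z k \<in> carrier_vec n" for k
    using mult_mat_vec_carrier[OF Yk x] by (simp add: z_def)
  have Suc: "z (Suc k) = Y *\<^sub>v z k" for k
    unfolding z_def using Y x by (rule pow_mat_Suc_vec)
  have "norm2_vec (z 1) \<le> norm2_vec (z 0)"
  proof (rule log_convex_bounded_imp_le)
    show "0 \<le> norm2_vec (z k)" for k by simp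
    show "norm2_vec (z k) \<le> (real n)\<^sup>2 * \<bar>c\<bar> * norm2_vec x" for k
      unfolding z_def by (rule norm2_vec_mult_le[OF Yk bound x])
    fix k
    have "(norm2_vec (z (Suc k)))\<^sup>2 = z k \<bullet> z (Suc (Suc k))"
      unfolding scalar_prod_self[symmetric]
      using scalar_prod_symmetric_mat[OF Y sym z z, of k "Suc k"] by (simp add: Suc)
    also have "\<dots> \<le> norm2_vec (z k) * norm2_vec (z (Suc (Suc k)))"
      using z by (intro scalar_prod_le_norm2_vec) (metis carrier_vecD)
    finally show "(norm2_vec (z (Suc k)))\<^sup>2 \<le> norm2_vec (z k) * norm2_vec (z (Suc (Suc k)))" .
  qed
  then show ?thesis using Suc[of 0] Y x by (simp add: z_def)
qed

section \<open>Damped iteration with a positive semidefinite contraction\<close>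

lemma norm2_vec_diff_sq:
  assumes "x \<in> carrier_vec n" "y \<in> carrier_vec n"
  shows "(norm2_vec (x - y))\<^sup>2 = (norm2_vec x)\<^sup>2 - 2 * (x \<bullet> y) + (norm2_vec y)\<^sup>2"
  unfolding scalar_prod_self[symmetric] using assms
  by (simp add: minus_scalar_prod_distrib[of _ n] scalar_prod_minus_distrib[of _ n]
      comm_scalar_prod[of y n x])

text \<open>In spectral terms the eigenvalues of Y lie in [0, 1]; the two inequalities express this
  without diagonalising Y.\<close>

locale psd_contraction =
  fixes n :: nat and Y :: "real mat"
  assumes Y: "Y \<in> carrier_mat n n" and sym: "transpose_mat Y = Y"
    and psd: "\<And>x. x \<in> carrier_vec n \<Longrightarrow> 0 \<le> x \<bullet> (Y *\<^sub>v x)"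
    and contraction: "\<And>x. x \<in> carrier_vec n \<Longrightarrow> norm2_vec (Y *\<^sub>v x) \<le> norm2_vec x"
begin

lemma mult_carrier [simp]: "x \<in> carrier_vec n \<Longrightarrow> Y *\<^sub>v x \<in> carrier_vec n"
  using Y by simp

text \<open>Positivity is tested at x - Y x. The last term of the expansion, the scalar product of Y
  x and Y (Y x), is at most |Y x|^2 by Cauchy-Schwarz and contraction.\<close>

lemma norm2_vec_sq_le:
  assumes x: "x \<in> carrier_vec n"
  shows "(norm2_vec (Y *\<^sub>v x))\<^sup>2 \<le> x \<bullet> (Y *\<^sub>v x)"
proof -
  have "0 \<le> (x - Y *\<^sub>v x) \<bullet> (Y *\<^sub>v (x - Y *\<^sub>v x))"
    using x by (intro psd) simp
  also have "\<dots> = x \<bullet> (Y *\<^sub>v x) - 2 * (norm2_vec (Y *\<^sub>v x))\<^sup>2 + (Y *\<^sub>v x) \<bullet> (Y *\<^sub>v (Y *\<^sub>v x))"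
    using x scalar_prod_symmetric_mat[OF Y sym x, of "Y *\<^sub>v x"]
    by (simp add: mult_minus_distrib_mat_vec[OF Y] minus_scalar_prod_distrib[of _ n]
        scalar_prod_minus_distrib[of _ n] flip: scalar_prod_self)
  finally have *: "2 * (norm2_vec (Y *\<^sub>v x))\<^sup>2 \<le> x \<bullet> (Y *\<^sub>v x) + (Y *\<^sub>v x) \<bullet> (Y *\<^sub>v (Y *\<^sub>v x))"
    by simp
  have "(Y *\<^sub>v x) \<bullet> (Y *\<^sub>v (Y *\<^sub>v x)) \<le> norm2_vec (Y *\<^sub>v x) * norm2_vec (Y *\<^sub>v (Y *\<^sub>v x))"
    using Y x by (intro scalar_prod_le_norm2_vec) auto
  also have "\<dots> \<le> norm2_vec (Y *\<^sub>v x) * norm2_vec (Y *\<^sub>v x)"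
    using x by (intro mult_left_mono contraction) auto
  finally show ?thesis using * by (simp add: power2_eq_square)
qed

text \<open>The mixed term of the expanded square is at least 2 |Y x|^2. The resulting loss per step
  from w to w - Y w is what telescopes below.\<close>

lemma norm2_vec_diff_le:
  assumes x: "x \<in> carrier_vec n"
  shows "(norm2_vec (x - Y *\<^sub>v x))\<^sup>2 \<le> (norm2_vec x)\<^sup>2 - (norm2_vec (Y *\<^sub>v x))\<^sup>2"
  using norm2_vec_sq_le[OF x] norm2_vec_diff_sq[of x n "Y *\<^sub>v x"] x by simp

text \<open>The \<nu> + 1 values |Y w_m|^2 with m \<le> \<nu> sum to at most |x|^2 and do not
  increase with m, so the last one is at most their average.\<close>

lemma smoothing:
  assumes x: "x \<in> carrier_vec n"
  shows "norm2_vec (Y *\<^sub>v ((1\<^sub>m n - Y) ^\<^sub>m \<nu> *\<^sub>v x)) \<le> norm2_vec x / sqrt (real (Suc \<nu>))"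
proof -
  define w where "w m = (1\<^sub>m n - Y) ^\<^sub>m m *\<^sub>v x" for m
  have M: "1\<^sub>m n - Y \<in> carrier_mat n n" using Y by (rule minus_carrier_mat)
  have w: "w m \<in> carrier_vec n" for m
    unfolding w_def using M x by (metis mult_mat_vec_carrier pow_carrier_mat)
  have w_Suc: "w (Suc m) = w m - Y *\<^sub>v w m" for m
    unfolding w_def pow_mat_Suc_vec[OF M x]
    using w[of m] Y by (simp add: minus_mult_distrib_mat_vec[OF one_carrier_mat Y] w_def)
  \<comment> \<open>Y commutes with 1 - Y, so Y w_(m+1) arises by applying 1 - Y to Y w_m, and 1 - Y
    does not increase norms.\<close>
  have dec: "norm2_vec (Y *\<^sub>v w (Suc m)) \<le> norm2_vec (Y *\<^sub>v w m)" for m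
  proof -
    have "Y *\<^sub>v w (Suc m) = Y *\<^sub>v w m - Y *\<^sub>v (Y *\<^sub>v w m)"
      unfolding w_Suc using w by (intro mult_minus_distrib_mat_vec[OF Y]) auto
    then have "(norm2_vec (Y *\<^sub>v w (Suc m)))\<^sup>2 \<le> (norm2_vec (Y *\<^sub>v w m))\<^sup>2"
      using norm2_vec_diff_le[of "Y *\<^sub>v w m"] w
      by (smt (verit) mult_carrier zero_le_power2)
    then show ?thesis by (simp add: power2_le_iff_abs_le)
  qed
  have mono: "norm2_vec (Y *\<^sub>v w \<nu>) \<le> norm2_vec (Y *\<^sub>v w m)" if "m \<le> \<nu>" for m
    using that by (rule lift_Suc_antimono_le[rotated]) (rule dec)
  have tel: "(\<Sum>m\<le>\<nu>. (norm2_vec (Y *\<^sub>v w m))\<^sup>2) \<le> (norm2_vec x)\<^sup>2 - (norm2_vec (w (Suc \<nu>)))\<^sup>2"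
    for \<nu>
  proof (induction \<nu>)
    case 0
    have "w 0 = x" unfolding w_def using x Y by simp
    then show ?case using norm2_vec_diff_le[OF x] by (simp add: w_Suc)
  next
    case (Suc \<nu>)
    then show ?case using norm2_vec_diff_le[OF w, of "Suc \<nu>"] by (simp add: w_Suc[of "Suc \<nu>"])
  qed
  have "real (Suc \<nu>) * (norm2_vec (Y *\<^sub>v w \<nu>))\<^sup>2 = (\<Sum>m\<le>\<nu>. (norm2_vec (Y *\<^sub>v w \<nu>))\<^sup>2)"
    by simp
  also have "\<dots> \<le> (\<Sum>m\<le>\<nu>. (norm2_vec (Y *\<^sub>v w m))\<^sup>2)"
    by (intro sum_mono power_mono mono) auto
  also have "\<dots> \<le> (norm2_vec x)\<^sup>2" using tel[of \<nu>] by (smt (verit) zero_le_power2)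
  finally have "(norm2_vec (Y *\<^sub>v w \<nu>))\<^sup>2 \<le> (norm2_vec x / sqrt (real (Suc \<nu>)))\<^sup>2"
    by (simp add: power_divide field_simps)
  then show ?thesis unfolding w_def by (rule power2_le_imp_le) simp
qed

end

section \<open>Smoothing for a single block\<close>

lemma jacobi_smoothing:
  fixes A :: "real mat"
  assumes A: "A \<in> carrier_mat n n" and sym: "transpose_mat A = A"
    and psd: "\<And>x. x \<in> carrier_vec n \<Longrightarrow> 0 \<le> x \<bullet> (A *\<^sub>v x)"
    and e: "\<And>i. i < n \<Longrightarrow> \<epsilon> \<le> e i" "0 < \<epsilon>" and \<omega>: "0 < \<omega>"
    and bound: "\<And>k. norm_bound ((\<omega> \<cdot>\<^sub>m (mat_diag n e * A)) ^\<^sub>m k) c"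
  shows "norm2_mat (A * (1\<^sub>m n - \<omega> \<cdot>\<^sub>m (mat_diag n e * A)) ^\<^sub>m \<nu>)
    \<le> 1 / (\<omega> * \<epsilon> * sqrt (real (Suc \<nu>)))"
proof -
  \<comment> \<open>With E = \<open>mat_diag n e\<close>, F is the square root of E and G its
    inverse; conjugating with them symmetrises T into Y.\<close>
  define F where "F = mat_diag n (\<lambda>i. sqrt (e i))"
  define G where "G = mat_diag n (\<lambda>i. 1 / sqrt (e i))"
  define Y where "Y = \<omega> \<cdot>\<^sub>m (F * A * F)"
  define T where "T = \<omega> \<cdot>\<^sub>m (mat_diag n e * A)"
  have pos: "0 < e i" if "i < n" for i using e that by (meson less_le_trans)
  have carrier: "F \<in> carrier_mat n n" "G \<in> carrier_mat n n" "Y \<in> carrier_mat n n" "T \<in> carrier_mat n n"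
    unfolding F_def G_def Y_def T_def
    by (intro smult_carrier_mat mult_carrier_mat[of _ n n _ n] mat_diag_dim A)+
  have FG: "F * G = 1\<^sub>m n"
    unfolding F_def G_def mat_diag_diag using pos by (intro eq_matI) (auto simp: mat_diag_def less_imp_neq[THEN not_sym])
  have GF: "G * F = 1\<^sub>m n"
    unfolding F_def G_def mat_diag_diag using pos by (intro eq_matI) (auto simp: mat_diag_def less_imp_neq[THEN not_sym])
  have FF: "F * F = mat_diag n e"
    unfolding F_def mat_diag_diag using pos by (intro eq_matI) (auto simp: mat_diag_def less_imp_le)
  have symF: "transpose_mat F = F"
    unfolding F_def by (intro eq_matI) (auto simp: mat_diag_def)
  have FAF: "F * A * F \<in> carrier_mat n n" using carrier A by auto
  \<comment> \<open>Used twice: P = F leads to T, and P = G leads to A.\<close>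
  have smult: "P * Y * G = \<omega> \<cdot>\<^sub>m (P * (F * A * F) * G)" if "P \<in> carrier_mat n n" for P
    unfolding Y_def using carrier FAF that
    by (simp add: mult_smult_distrib[OF _ FAF] mult_smult_assoc_mat[of "P * (F * A * F)" n n G n])
  have "F * (F * A * F) * G = (F * F) * A * (F * G)"
    using carrier A by (simp add: assoc_mult_mat[of _ n n _ n _ n])
  then have T: "T = F * Y * G"
    unfolding smult[OF carrier(1)] T_def using A by (simp add: FF FG)
  have "G * (F * A * F) * G = (G * F) * A * (F * G)"
    using carrier A by (simp add: assoc_mult_mat[of _ n n _ n _ n])
  then have "G * (F * A * F) * G = A"
    using A by (simp add: GF FG)
  then have A_eq: "A = (1 / \<omega>) \<cdot>\<^sub>m (G * Y * G)"
    unfolding smult[OF carrier(2)] using \<omega> by (intro eq_matI) auto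
  have sim: "similar_mat_wit Y T G F"
    by (rule similar_mat_wit_sym, rule similar_mat_witI[OF FG GF T]) (use carrier in auto)
  \<comment> \<open>Since Y^k = G T^k F, a bound on the powers of T carries over with a constant
    depending on F, G and n. Its size is harmless, as the contraction estimate does not contain
    it.\<close>
  obtain c' where c': "norm_bound (Y ^\<^sub>m k) c'" for k
  proof -
    obtain cF where cF: "norm_bound F cF" using norm_bound_max by blast
    obtain cG where cG: "norm_bound G cG" using norm_bound_max by blast
    have "norm_bound (Y ^\<^sub>m k) (cG * c * of_nat n * cF * of_nat n)" for k
      unfolding similar_mat_wit_pow_id[OF sim]
      using carrier cF cG bound[folded T_def]
      by (intro norm_bound_mult[of _ n n] norm_bound_mult) auto
    then show ?thesis using that by blast
  qed
  have symY: "transpose_mat Y = Y"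
  proof -
    have "transpose_mat (F * A * F) = F * A * F"
      using carrier A by (simp add: transpose_mult[of _ n n _ n] symF sym assoc_mult_mat[of _ n n _ n _ n])
    then show ?thesis unfolding Y_def
      by (simp add: transpose_smult_mat)
  qed
  interpret psd_contraction n Y
  proof
    fix x :: "real vec" assume x: "x \<in> carrier_vec n"
    have Fx: "F *\<^sub>v x \<in> carrier_vec n" using carrier x by simp
    have "x \<bullet> (Y *\<^sub>v x) = \<omega> * (x \<bullet> (F *\<^sub>v (A *\<^sub>v (F *\<^sub>v x))))"
      unfolding Y_def smult_mat_mult_vec[OF FAF x] using carrier A x
      by (simp add: assoc_mult_mat_vec[of _ n n _ n])
    also have "\<dots> = \<omega> * ((F *\<^sub>v x) \<bullet> (A *\<^sub>v (F *\<^sub>v x)))"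
      using scalar_prod_symmetric_mat[OF carrier(1) symF x, of "A *\<^sub>v (F *\<^sub>v x)"] A Fx by simp
    finally show "0 \<le> x \<bullet> (Y *\<^sub>v x)" using psd[OF Fx] \<omega> by simp
    show "norm2_vec (Y *\<^sub>v x) \<le> norm2_vec x"
      by (rule symmetric_power_bounded_contraction[OF carrier(3) symY c' x])
  qed (use carrier symY in auto)
  \<comment> \<open>The similarity fixes the identity, so it also relates 1 - T to 1 - Y.\<close>
  have S: "similar_mat_wit (1\<^sub>m n - T) (1\<^sub>m n - Y) F G"
  proof (rule similar_mat_witI[OF FG GF])
    have "F * (1\<^sub>m n - Y) * G = (F - F * Y) * G"
      using carrier by (simp add: mult_minus_distrib_mat[of F n n _ n])
    also have "\<dots> = 1\<^sub>m n - T"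
      using carrier by (simp add: minus_mult_distrib_mat[of _ n n _ _ n] FG T)
    finally show "1\<^sub>m n - T = F * (1\<^sub>m n - Y) * G" by simp
  qed (use carrier in auto)
  \<comment> \<open>The inner product G F cancels and one G remains on each side of Y (1 - Y)^\<nu>.
    Each G then costs a factor 1 / sqrt \<epsilon>.\<close>
  have AS: "A * (1\<^sub>m n - T) ^\<^sub>m \<nu> *\<^sub>v x = (1 / \<omega>) \<cdot>\<^sub>v (G *\<^sub>v (Y *\<^sub>v ((1\<^sub>m n - Y) ^\<^sub>m \<nu> *\<^sub>v (G *\<^sub>v x))))"
    if x: "x \<in> carrier_vec n" for x
  proof -
    define P where "P = (1\<^sub>m n - Y) ^\<^sub>m \<nu>"
    have P: "P \<in> carrier_mat n n" unfolding P_def using carrier by (intro pow_carrier_mat minus_carrier_mat)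
    have "A * (1\<^sub>m n - T) ^\<^sub>m \<nu> *\<^sub>v x = A *\<^sub>v (F *\<^sub>v (P *\<^sub>v (G *\<^sub>v x)))"
      unfolding similar_mat_wit_pow_id[OF S] P_def[symmetric]
      using A carrier P x by (simp add: assoc_mult_mat_vec[of _ n n _ n])
    also have "\<dots> = (1 / \<omega>) \<cdot>\<^sub>v ((G * Y * G) *\<^sub>v (F *\<^sub>v (P *\<^sub>v (G *\<^sub>v x))))"
      by (subst A_eq, rule smult_mat_mult_vec[of _ n n]) (use carrier P x in auto)
    also have "(G * Y * G) *\<^sub>v (F *\<^sub>v (P *\<^sub>v (G *\<^sub>v x))) = G *\<^sub>v (Y *\<^sub>v ((G * F) *\<^sub>v (P *\<^sub>v (G *\<^sub>v x))))"
      using carrier P x by (simp add: assoc_mult_mat_vec[of _ n n _ n])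
    also have "(G * F) *\<^sub>v (P *\<^sub>v (G *\<^sub>v x)) = P *\<^sub>v (G *\<^sub>v x)"
      unfolding GF using carrier P x by (intro one_mult_mat_vec) auto
    finally show ?thesis unfolding P_def .
  qed
  have Gle: "norm2_vec (G *\<^sub>v x) \<le> 1 / sqrt \<epsilon> * norm2_vec x" if "x \<in> carrier_vec n" for x
    unfolding G_def
  proof (rule norm2_vec_diag_le[OF that])
    fix i assume "i < n"
    then show "\<bar>1 / sqrt (e i)\<bar> \<le> 1 / sqrt \<epsilon>"
      using e pos[of i] by (simp add: frac_le)
  qed (use e in simp)
  show ?thesis
    unfolding T_def[symmetric]
  proof (rule norm2_mat_le)
    show "A * (1\<^sub>m n - T) ^\<^sub>m \<nu> \<in> carrier_mat n n"
      using A carrier by (intro mult_carrier_mat[OF A] pow_carrier_mat minus_carrier_mat)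
    show "0 \<le> 1 / (\<omega> * \<epsilon> * sqrt (real (Suc \<nu>)))" using \<omega> e by simp
    fix x :: "real vec" assume x: "x \<in> carrier_vec n"
    have Gx: "G *\<^sub>v x \<in> carrier_vec n" using carrier x by simp
    have P: "(1\<^sub>m n - Y) ^\<^sub>m \<nu> \<in> carrier_mat n n" using carrier by (intro pow_carrier_mat minus_carrier_mat)
    let ?y = "Y *\<^sub>v ((1\<^sub>m n - Y) ^\<^sub>m \<nu> *\<^sub>v (G *\<^sub>v x))"
    have y: "?y \<in> carrier_vec n" using P Gx carrier by (meson mult_mat_vec_carrier)
    have "norm2_vec (G *\<^sub>v ?y) \<le> 1 / sqrt \<epsilon> * norm2_vec ?y" by (rule Gle[OF y])
    also have "\<dots> \<le> 1 / sqrt \<epsilon> * (norm2_vec (G *\<^sub>v x) / sqrt (real (Suc \<nu>)))"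
      using e by (intro mult_left_mono smoothing Gx) simp
    also have "\<dots> \<le> 1 / sqrt \<epsilon> * ((1 / sqrt \<epsilon> * norm2_vec x) / sqrt (real (Suc \<nu>)))"
      using e by (intro mult_left_mono divide_right_mono Gle x) auto
    also have "\<dots> = norm2_vec x / (\<epsilon> * sqrt (real (Suc \<nu>)))"
      using e by (simp add: field_simps flip: power2_eq_square)
    finally have "norm2_vec (G *\<^sub>v ?y) \<le> norm2_vec x / (\<epsilon> * sqrt (real (Suc \<nu>)))" .
    then have "1 / \<omega> * norm2_vec (G *\<^sub>v ?y) \<le> 1 / \<omega> * (norm2_vec x / (\<epsilon> * sqrt (real (Suc \<nu>))))"
      using \<omega> by (intro mult_left_mono) auto
    then show "norm2_vec (A * (1\<^sub>m n - T) ^\<^sub>m \<nu> *\<^sub>v x)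
      \<le> 1 / (\<omega> * \<epsilon> * sqrt (real (Suc \<nu>))) * norm2_vec x"
      unfolding AS[OF x] norm2_vec_smult using \<omega> by (simp add: mult.assoc)
  qed
qed

section \<open>Tensor products of diagonal matrices\<close>

lemma kron_carrier [simp]:
  "A \<in> carrier_mat m m' \<Longrightarrow> B \<in> carrier_mat l l' \<Longrightarrow> A \<otimes>\<^sub>K B \<in> carrier_mat (m * l) (m' * l')"
  by (simp add: kron_def)

lemma kron_index:
  assumes "A \<in> carrier_mat m m'" "B \<in> carrier_mat l l'" "i < m * l" "j < m' * l'"
  shows "(A \<otimes>\<^sub>K B) $$ (i, j) = A $$ (i div l, j div l') * B $$ (i mod l, j mod l')"
  using assms by (auto simp: kron_def)

lemma kron_mat_diag:
  fixes f g :: "nat \<Rightarrow> 'a::semiring_0"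
  shows "mat_diag m f \<otimes>\<^sub>K mat_diag l g = mat_diag (m * l) (\<lambda>i. f (i div l) * g (i mod l))"
proof (rule eq_matI)
  fix i j assume "i < dim_row (mat_diag (m * l) (\<lambda>i. f (i div l) * g (i mod l)))"
    "j < dim_col (mat_diag (m * l) (\<lambda>i. f (i div l) * g (i mod l)))"
  then have i: "i < m * l" and j: "j < m * l" by (auto simp: mat_diag_def)
  have l: "0 < l" using i by (cases l) auto
  have "i div l < m" "j div l < m" "i mod l < l" "j mod l < l"
    using i j l by (auto simp: less_mult_imp_div_less)
  moreover have "i = j" if "i div l = j div l" "i mod l = j mod l"
    using that by (metis div_mult_mod_eq)
  ultimately show "(mat_diag m f \<otimes>\<^sub>K mat_diag l g) $$ (i, j) = mat_diag (m * l) (\<lambda>i. f (i div l) * g (i mod l)) $$ (i, j)"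
    unfolding kron_index[OF mat_diag_dim mat_diag_dim i j] using i j
    by (auto simp: mat_diag_def)
qed (auto simp: mat_diag_def kron_def)

lemma tensor_0: "tensor 0 F = F 0 \<otimes>\<^sub>K 1\<^sub>m 1"
  by (simp add: tensor_def)

lemma tensor_Suc: "tensor (Suc d) F = F (Suc d) \<otimes>\<^sub>K tensor d F"
  by (simp add: tensor_def)

lemma smult_mat_diag: "c \<cdot>\<^sub>m mat_diag n f = mat_diag n (\<lambda>i. c * f i)" for c :: "'a::semiring_0"
  by (intro eq_matI) (auto simp: mat_diag_def)

lemma add_mat_diag: "mat_diag n f + mat_diag n g = mat_diag n (\<lambda>i. f i + g i)" for f g :: "nat \<Rightarrow> 'a::monoid_add"
  by (intro eq_matI) (auto simp: mat_diag_def)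

lemma mat_diag_index: "i < n \<Longrightarrow> j < n \<Longrightarrow> mat_diag n f $$ (i, j) = (if i = j then f j else 0)"
  by (simp add: mat_diag_def)

lemma pow_mat_diag: "mat_diag n f ^\<^sub>m k = mat_diag n (\<lambda>i. f i ^ k)" for f :: "nat \<Rightarrow> 'a::comm_semiring_1"
proof (induction k)
  case 0
  have "mat_diag n f ^\<^sub>m 0 = 1\<^sub>m n" by (simp add: mat_diag_def)
  then show ?case by (simp flip: mat_diag_one)
qed (simp add: mult.commute)

text \<open>On the whole space only diagonality is recorded; entries are computed one block at a
  time, by \<open>tensor_block_row\<close>.\<close>

lemma tensor_mat_diag:
  assumes "\<And>\<mu>. \<mu> \<le> d \<Longrightarrow> \<exists>f. F \<mu> = mat_diag (m \<mu>) f"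
  shows "\<exists>f. tensor d F = mat_diag (\<Prod>\<mu>\<le>d. m \<mu>) (f :: nat \<Rightarrow> 'a::semiring_1)"
  using assms
proof (induction d)
  case 0
  then obtain f where "F 0 = mat_diag (m 0) f" by blast
  \<comment> \<open>The fold in \<open>tensor\<close> starts from the 1 x 1 identity, hence the
    trivial factor 1.\<close>
  then have "tensor 0 F = mat_diag (m 0 * 1) (\<lambda>i. f (i div 1) * 1)"
    unfolding tensor_0 by (simp add: kron_mat_diag flip: mat_diag_one)
  then show ?case by auto
next
  case (Suc d)
  then obtain f g where "F (Suc d) = mat_diag (m (Suc d)) f" "tensor d F = mat_diag (\<Prod>\<mu>\<le>d. m \<mu>) g"
    by (metis le_SucI order_refl)
  then have "tensor (Suc d) F = mat_diag (m (Suc d) * (\<Prod>\<mu>\<le>d. m \<mu>))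
     (\<lambda>i. f (i div (\<Prod>\<mu>\<le>d. m \<mu>)) * g (i mod (\<Prod>\<mu>\<le>d. m \<mu>)))"
    unfolding tensor_Suc by (simp add: kron_mat_diag)
  then show ?case by (auto simp: mult.commute)
qed

lemma msum_carrier:
  "(\<And>x. x \<in> set is \<Longrightarrow> F x \<in> carrier_mat N N) \<Longrightarrow> msum N F is \<in> carrier_mat N N"
  by (induction "is") (auto simp: msum_def)

lemma msum_index:
  fixes F :: "nat \<Rightarrow> 'a::monoid_add mat"
  assumes "\<And>x. x \<in> set is \<Longrightarrow> F x \<in> carrier_mat N N" "i < N" "j < N"
  shows "msum N F is $$ (i, j) = (\<Sum>x\<leftarrow>is. F x $$ (i, j))"
  using assms(1)
proof (induction "is")
  case Nil then show ?case using assms by (simp add: msum_def)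
next
  case (Cons x xs)
  have "msum N F (x # xs) = F x + msum N F xs" by (simp add: msum_def)
  moreover have "msum N F xs \<in> carrier_mat N N" using Cons by (intro msum_carrier) auto
  ultimately show ?case using Cons assms by simp
qed

lemma msum_mat_diag:
  fixes f :: "nat \<Rightarrow> nat \<Rightarrow> 'a::monoid_add"
  assumes "\<And>x. x \<in> set is \<Longrightarrow> F x = mat_diag N (f x)"
  shows "msum N F is = mat_diag N (\<lambda>i. \<Sum>x\<leftarrow>is. f x i)"
  using assms
proof (induction "is")
  case Nil
  show ?case unfolding msum_def by (intro eq_matI) (auto simp: mat_diag_def)
next
  case (Cons x xs)
  then show ?case by (simp add: msum_def add_mat_diag)
qed

section \<open>Exponentials and spectra of diagonal matrices\<close>

lemma mat_exp_mat_diag: "mat_exp (mat_diag n f) = mat_diag n (\<lambda>i. exp (f i))"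
proof (rule eq_matI)
  fix i j assume "i < dim_row (mat_diag n (\<lambda>i. exp (f i)))" "j < dim_col (mat_diag n (\<lambda>i. exp (f i)))"
  then have ij: "i < n" "j < n" by (auto simp: mat_diag_def)
  have "mat_exp (mat_diag n f) $$ (i, j) = (\<Sum>r. (if i = j then f j ^ r else 0) / fact r)"
    unfolding mat_exp_def pow_mat_diag using ij
    by (auto simp: mat_diag_index mat_diag_def intro!: suminf_cong)
  also have "\<dots> = (if i = j then exp (f j) else 0)"
    by (simp add: exp_def divide_inverse mult.commute)
  finally show "mat_exp (mat_diag n f) $$ (i, j) = mat_diag n (\<lambda>i. exp (f i)) $$ (i, j)"
    using ij by (simp add: mat_diag_index)
qed (auto simp: mat_exp_def mat_diag_def)

lemma E_star_mat_diag:
  "E_star a k \<alpha> \<beta> (mat_diag N f) = mat_diag N (\<lambda>i. exp_sum k (\<lambda>m. \<alpha> m / a) (\<lambda>m. \<beta> m / a) (f i))"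
proof -
  have "E_star a k \<alpha> \<beta> (mat_diag N f)
      = msum N (\<lambda>m. (\<alpha> m / a) \<cdot>\<^sub>m mat_exp (- (\<beta> m / a) \<cdot>\<^sub>m mat_diag N f)) [1..<Suc k]"
    by (simp add: E_star_def exp_sum_mat_def mat_diag_def)
  also have "\<dots> = mat_diag N (\<lambda>i. \<Sum>m\<leftarrow>[1..<Suc k]. \<alpha> m / a * exp (- (\<beta> m / a) * f i))"
    by (rule msum_mat_diag) (simp add: smult_mat_diag mat_exp_mat_diag)
  also have "\<dots> = mat_diag N (\<lambda>i. exp_sum k (\<lambda>m. \<alpha> m / a) (\<lambda>m. \<beta> m / a) (f i))"
    unfolding exp_sum_def
    by (simp only: interv_sum_list_conv_sum_set_nat atLeastLessThanSuc_atLeastAtMost set_upt)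
  finally show ?thesis .
qed

text \<open>The i-th unit vector is an eigenvector. This turns the spectral inclusion into bounds on
  single diagonal entries.\<close>

lemma mat_diag_entry_in_cspectrum:
  assumes "i < N"
  shows "complex_of_real (f i) \<in> cspectrum (mat_diag N f)"
proof -
  have "map_mat complex_of_real (mat_diag N f) = mat_diag N (\<lambda>i. complex_of_real (f i))"
    by (intro eq_matI) (auto simp: mat_diag_def)
  then have "map_mat complex_of_real (mat_diag N f) *\<^sub>v unit_vec N i = complex_of_real (f i) \<cdot>\<^sub>v unit_vec N i"
    using assms by (intro eq_vecI) (auto simp: mat_diag_def)
  moreover have "unit_vec N i \<noteq> (0\<^sub>v N :: complex vec)"
    using assms by (metis index_unit_vec(2) index_zero_vec(1) zero_neq_one)
  ultimately show ?thesis
    using assms unfolding cspectrum_def spectrum_def eigenvalue_def eigenvector_def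
    by (auto simp: mat_diag_def intro!: exI[of _ "unit_vec N i"])
qed

section \<open>Mixed-radix positions of the blocks\<close>

definition block_pos :: "nat \<Rightarrow> (nat \<Rightarrow> nat) \<Rightarrow> (nat \<Rightarrow> nat) \<Rightarrow> nat" where
  "block_pos d n j = (\<Sum>\<nu>=1..d. j \<nu> * (\<Prod>\<mu>=1..<\<nu>. n \<mu>))"

text \<open>The last component is the leading digit, in accordance with \<open>tensor\<close>, where
  the factor of largest index comes first.\<close>

lemma block_pos_Suc: "block_pos (Suc d) n j = j (Suc d) * (\<Prod>\<mu>=1..d. n \<mu>) + block_pos d n j"
  by (simp add: block_pos_def atLeastLessThanSuc_atLeastAtMost add.commute)

lemma block_pos_less:
  assumes "\<And>\<mu>. \<mu> \<in> {1..d} \<Longrightarrow> j \<mu> < n \<mu>"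
  shows "block_pos d n j < (\<Prod>\<mu>=1..d. n \<mu>)"
  using assms
proof (induction d)
  case 0 then show ?case by (simp add: block_pos_def)
next
  case (Suc d)
  have "block_pos d n j < (\<Prod>\<mu>=1..d. n \<mu>)" using Suc by simp
  then have "block_pos (Suc d) n j < Suc (j (Suc d)) * (\<Prod>\<mu>=1..d. n \<mu>)"
    unfolding block_pos_Suc by simp
  also have "\<dots> \<le> n (Suc d) * (\<Prod>\<mu>=1..d. n \<mu>)"
    using Suc.prems[of "Suc d"] by (intro mult_right_mono) auto
  finally show ?case by (simp add: mult.commute)
qed

lemma block_row_less:
  fixes q :: nat
  assumes "q < P" "r < l"
  shows "q * l + r < P * l"
proof -
  have "q * l + r < Suc q * l" using assms by simp
  also have "\<dots> \<le> P * l" using assms by (intro mult_right_mono) auto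
  finally show ?thesis .
qed

lemma tensor_carrier:
  assumes "F 0 \<in> carrier_mat n0 n0" "\<And>\<mu>. \<mu> \<in> {1..d} \<Longrightarrow> F \<mu> \<in> carrier_mat (n \<mu>) (n \<mu>)"
  shows "tensor d F \<in> carrier_mat ((\<Prod>\<mu>=1..d. n \<mu>) * n0) ((\<Prod>\<mu>=1..d. n \<mu>) * n0)"
  using assms(2)
proof (induction d)
  case 0
  then show ?case using kron_carrier[OF assms(1) one_carrier_mat[of 1]] by (simp add: tensor_0)
next
  case (Suc d)
  have "tensor (Suc d) F \<in> carrier_mat (n (Suc d) * ((\<Prod>\<mu>=1..d. n \<mu>) * n0)) (n (Suc d) * ((\<Prod>\<mu>=1..d. n \<mu>) * n0))"
    unfolding tensor_Suc using Suc by (intro kron_carrier) auto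
  then show ?case by (simp add: ac_simps)
qed

text \<open>All factors but \<open>F 0\<close> are diagonal, and the digits of the block number
  select one entry of each. A column in another block differs in some digit and meets an
  off-diagonal zero there. Describing the whole row gives both the block and the zeros beside
  it.\<close>

lemma tensor_block_row:
  fixes f :: "nat \<Rightarrow> nat \<Rightarrow> 'a::comm_semiring_1"
  assumes F0: "F 0 \<in> carrier_mat n0 n0"
    and "\<And>\<mu>. \<mu> \<in> {1..d} \<Longrightarrow> F \<mu> = mat_diag (n \<mu>) (f \<mu>)"
    and "\<And>\<mu>. \<mu> \<in> {1..d} \<Longrightarrow> j \<mu> < n \<mu>"
    and r: "r < n0" and "c < (\<Prod>\<mu>=1..d. n \<mu>) * n0"
  shows "tensor d F $$ (block_pos d n j * n0 + r, c) =
    (if c div n0 = block_pos d n j then (\<Prod>\<mu>=1..d. f \<mu> (j \<mu>)) * F 0 $$ (r, c mod n0) else 0)"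
  using assms(2,3,5)
proof (induction d arbitrary: c)
  case 0
  then have c: "c < n0" by simp
  have "tensor 0 F $$ (r, c) = F 0 $$ (r, c)"
    unfolding tensor_0 using kron_index[OF F0 one_carrier_mat[of 1], of r c] r c by simp
  then show ?case using c by (simp add: block_pos_def)
next
  case (Suc d)
  define P where "P = (\<Prod>\<mu>=1..d. n \<mu>)"
  define q where "q = block_pos d n j"
  define J where "J = j (Suc d)"
  have q: "q < P" unfolding q_def P_def using Suc.prems by (intro block_pos_less) auto
  have J: "J < n (Suc d)" unfolding J_def using Suc.prems(2)[of "Suc d"] by simp
  have qr: "q * n0 + r < P * n0" using q r by (rule block_row_less)
  have c: "c < n (Suc d) * (P * n0)" using Suc.prems(3) by (simp add: P_def ac_simps)
  \<comment> \<open>Splits off the outermost factor: J is the leading digit, and q * n0 + r is the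
    row in the remaining product.\<close>
  have row: "block_pos (Suc d) n j * n0 + r = J * (P * n0) + (q * n0 + r)"
    by (simp add: block_pos_Suc P_def q_def J_def algebra_simps)
  have row_less: "J * (P * n0) + (q * n0 + r) < n (Suc d) * (P * n0)"
    using J qr by (rule block_row_less)
  have "0 < P * n0" using qr by (rule order.strict_trans1[rotated]) simp
  then have row_div: "(J * (P * n0) + (q * n0 + r)) div (P * n0) = J"
    using qr by (metis add.right_neutral div_less div_mult_self3 less_not_refl2)
  have row_mod: "(J * (P * n0) + (q * n0 + r)) mod (P * n0) = q * n0 + r"
    using qr by simp
  have cdiv: "c div (P * n0) < n (Suc d)" using c by (simp add: less_mult_imp_div_less)
  have cmod: "c mod (P * n0) < P * n0" by (intro mod_less_divisor order.strict_trans1[OF _ qr]) simp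
  have T: "tensor d F \<in> carrier_mat (P * n0) (P * n0)"
    unfolding P_def using F0 Suc.prems(1) by (intro tensor_carrier) auto
  have FS: "F (Suc d) = mat_diag (n (Suc d)) (f (Suc d))" using Suc.prems(1)[of "Suc d"] by simp
  have "tensor (Suc d) F $$ (J * (P * n0) + (q * n0 + r), c)
    = F (Suc d) $$ (J, c div (P * n0)) * tensor d F $$ (q * n0 + r, c mod (P * n0))"
    unfolding tensor_Suc FS kron_index[OF mat_diag_dim T row_less c] row_div row_mod by simp
  also have "tensor d F $$ (q * n0 + r, c mod (P * n0)) =
      (if c mod (P * n0) div n0 = q then (\<Prod>\<mu>=1..d. f \<mu> (j \<mu>)) * F 0 $$ (r, c mod n0) else 0)"
    using Suc.IH[of "c mod (P * n0)"] Suc.prems cmod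
    by (simp add: P_def q_def mod_mult_self4 mod_mod_cancel)
  also have "F (Suc d) $$ (J, c div (P * n0)) = (if J = c div (P * n0) then f (Suc d) J else 0)"
    unfolding FS using J cdiv by (auto simp: mat_diag_index)
  \<comment> \<open>The column's block number in the smaller product is c div n0 without its leading
    digit.\<close>
  also have "c mod (P * n0) div n0 = c div n0 mod P"
  proof -
    have "c mod (P * n0) = n0 * (c div n0 mod P) + c mod n0"
      by (simp add: mult.commute[of P] mod_mult2_eq)
    then show ?thesis using r by simp
  qed
  also have "c div (P * n0) = c div n0 div P"
    by (metis div_mult2_eq mult.commute)
  finally have eq: "tensor (Suc d) F $$ (J * (P * n0) + (q * n0 + r), c) =
    (if J = c div n0 div P then f (Suc d) J else 0) *
    (if c div n0 mod P = q then (\<Prod>\<mu>=1..d. f \<mu> (j \<mu>)) * F 0 $$ (r, c mod n0) else 0)" .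
  \<comment> \<open>As q < P, agreement of leading digit and remainder is agreement of block
    numbers.\<close>
  have split: "c div n0 = J * P + q \<longleftrightarrow> J = c div n0 div P \<and> c div n0 mod P = q"
  proof
    assume "c div n0 = J * P + q"
    then show "J = c div n0 div P \<and> c div n0 mod P = q" using q by simp
  next
    assume "J = c div n0 div P \<and> c div n0 mod P = q"
    then show "c div n0 = J * P + q" by (metis div_mult_mod_eq)
  qed
  have pos: "block_pos (Suc d) n j = J * P + q"
    by (simp add: block_pos_Suc P_def q_def J_def)
  have prod: "(\<Prod>\<mu>=1..Suc d. f \<mu> (j \<mu>)) = f (Suc d) J * (\<Prod>\<mu>=1..d. f \<mu> (j \<mu>))"
    by (simp add: J_def mult.commute)
  show ?case
    unfolding row eq unfolding pos prod split by (auto simp: mult.assoc)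
qed

section \<open>Diagonal blocks\<close>

text \<open>Taking the position itself instead of a multi-index, as \<open>block\<close> does, frees
  the algebra of blocks from digits.\<close>

definition diag_block :: "nat \<Rightarrow> nat \<Rightarrow> 'a mat \<Rightarrow> 'a mat" where
  "diag_block l q M = mat l l (\<lambda>(r, s). M $$ (q * l + r, q * l + s))"

lemma block_eq_diag_block: "block d n l M j = diag_block l (block_pos d n j) M"
  by (simp add: block_def diag_block_def block_pos_def)

lemma dim_diag_block [simp]: "dim_row (diag_block l q M) = l" "dim_col (diag_block l q M) = l"
  by (simp_all add: diag_block_def)

text \<open>Only the rows of block q are constrained. With such a left factor, extracting block q is
  already multiplicative, whatever the right factor is.\<close>

definition row_in_block :: "nat \<Rightarrow> nat \<Rightarrow> 'a::zero mat \<Rightarrow> bool" where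
  "row_in_block l q M \<longleftrightarrow> (\<forall>r<l. \<forall>c<dim_col M. c div l \<noteq> q \<longrightarrow> M $$ (q * l + r, c) = 0)"

lemma row_in_block_mult_index:
  fixes M :: "'a::semiring_0 mat"
  assumes M: "M \<in> carrier_mat (P * l) (P * l)" and row: "row_in_block l q M"
    and M': "M' \<in> carrier_mat (P * l) m" and q: "q < P" and r: "r < l" and c: "c < m"
  shows "(M * M') $$ (q * l + r, c) = (\<Sum>s = 0..<l. M $$ (q * l + r, q * l + s) * M' $$ (q * l + s, c))"
proof -
  have "(M * M') $$ (q * l + r, c) = (\<Sum>i = 0..<P * l. M $$ (q * l + r, i) * M' $$ (i, c))"
    using M M' block_row_less[OF q r] c by (simp add: scalar_prod_def)
  also have "\<dots> = (\<Sum>i\<in>(\<lambda>s. q * l + s) ` {0..<l}. M $$ (q * l + r, i) * M' $$ (i, c))"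
  proof (rule sum.mono_neutral_right)
    show "(\<lambda>s. q * l + s) ` {0..<l} \<subseteq> {0..<P * l}"
      by (intro image_subsetI) (use block_row_less[OF q] in simp)
    show "\<forall>i\<in>{0..<P * l} - (\<lambda>s. q * l + s) ` {0..<l}. M $$ (q * l + r, i) * M' $$ (i, c) = 0"
    proof
      fix i assume i: "i \<in> {0..<P * l} - (\<lambda>s. q * l + s) ` {0..<l}"
      have "i div l \<noteq> q"
      proof
        assume "i div l = q"
        then have "i = q * l + i mod l" by auto
        moreover have "i mod l < l" using r by simp
        ultimately show False using i by (metis DiffD2 atLeast0LessThan image_eqI lessThan_iff)
      qed
      then show "M $$ (q * l + r, i) * M' $$ (i, c) = 0"
        using row M r i by (auto simp: row_in_block_def)
    qed
  qed simp
  also have "\<dots> = (\<Sum>s = 0..<l. M $$ (q * l + r, q * l + s) * M' $$ (q * l + s, c))"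
    by (subst sum.reindex) (auto simp: inj_on_def)
  finally show ?thesis .
qed

lemma diag_block_mult:
  fixes M :: "'a::semiring_0 mat"
  assumes M: "M \<in> carrier_mat (P * l) (P * l)" and row: "row_in_block l q M"
    and M': "M' \<in> carrier_mat (P * l) (P * l)" and q: "q < P"
  shows "diag_block l q (M * M') = diag_block l q M * diag_block l q M'"
  using row_in_block_mult_index[OF M row M' q] block_row_less[OF q]
  by (intro eq_matI) (auto simp: diag_block_def scalar_prod_def)

lemma row_in_block_mult:
  fixes M :: "'a::semiring_0 mat"
  assumes M: "M \<in> carrier_mat (P * l) (P * l)" and row: "row_in_block l q M"
    and M': "M' \<in> carrier_mat (P * l) (P * l)" "row_in_block l q M'" and q: "q < P"
  shows "row_in_block l q (M * M')"
  unfolding row_in_block_def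
proof (intro allI impI)
  fix r c assume "r < l" "c < dim_col (M * M')" "c div l \<noteq> q"
  then show "(M * M') $$ (q * l + r, c) = 0"
    using row_in_block_mult_index[OF M row M'(1) q, of r c] M' by (auto simp: row_in_block_def)
qed

lemma row_in_block_mat_diag:
  assumes "q < P"
  shows "row_in_block l q (mat_diag (P * l) f)"
  unfolding row_in_block_def
proof (intro allI impI)
  fix r c assume "r < l" "c < dim_col (mat_diag (P * l) f)" "c div l \<noteq> q"
  moreover from this have "c \<noteq> q * l + r" by auto
  ultimately show "mat_diag (P * l) f $$ (q * l + r, c) = 0"
    using block_row_less[OF assms, of r l] by (auto simp: mat_diag_def)
qed

lemma diag_block_mat_diag:
  assumes "q < P"
  shows "diag_block l q (mat_diag (P * l) f) = mat_diag l (\<lambda>r. f (q * l + r))"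
  using block_row_less[OF assms] by (intro eq_matI) (auto simp: diag_block_def mat_diag_def)

lemma diag_block_one:
  assumes "q < P"
  shows "diag_block l q (1\<^sub>m (P * l)) = 1\<^sub>m l"
  using diag_block_mat_diag[OF assms, of l "\<lambda>_. 1"] by simp

lemma diag_block_pow:
  fixes M :: "'a::semiring_1 mat"
  assumes M: "M \<in> carrier_mat (P * l) (P * l)" and row: "row_in_block l q M" and q: "q < P"
  shows "diag_block l q (M ^\<^sub>m k) = diag_block l q M ^\<^sub>m k"
proof -
  \<comment> \<open>Both claims go through the induction together: M^k is the left factor of
    M^(k+1), so the product rule needs its rows.\<close>
  have "row_in_block l q (M ^\<^sub>m k) \<and> diag_block l q (M ^\<^sub>m k) = diag_block l q M ^\<^sub>m k"
  proof (induction k)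
    case 0
    have "M ^\<^sub>m 0 = 1\<^sub>m (P * l)" using M by simp
    then show ?case
      using row_in_block_mat_diag[OF q, of l "\<lambda>_. 1 :: 'a"] by (simp add: diag_block_one[OF q])
  next
    case (Suc k)
    then show ?case
      using diag_block_mult[OF pow_carrier_mat[OF M] _ M q] row_in_block_mult[OF pow_carrier_mat[OF M] _ M row q]
      by simp
  qed
  then show ?thesis by simp
qed

lemma norm_bound_diag_block:
  assumes "M \<in> carrier_mat (P * l) (P * l)" "norm_bound M c" "q < P"
  shows "norm_bound (diag_block l q M) c"
  using assms block_row_less[OF assms(3)] by (auto simp: norm_bound_def diag_block_def)

text \<open>An eigenvalue of maximal modulus of the scaled matrix, divided by \<omega>, is an
  eigenvalue of M. Hence the scaled matrix has spectral radius below 1, and its powers are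
  bounded.\<close>

lemma spectral_radius_power_bound:
  fixes M :: "real mat"
  assumes M: "M \<in> carrier_mat N N" and N: "0 < N" and \<omega>: "0 < \<omega>" "\<omega> * rho M < 1"
  shows "\<exists>c. \<forall>k. norm_bound ((\<omega> \<cdot>\<^sub>m M) ^\<^sub>m k) c"
proof -
  let ?C = "map_mat complex_of_real M" and ?T = "map_mat complex_of_real (\<omega> \<cdot>\<^sub>m M)"
  have C: "?C \<in> carrier_mat N N" and T: "?T \<in> carrier_mat N N" using M by auto
  have T_eq: "?T = complex_of_real \<omega> \<cdot>\<^sub>m ?C" by (intro eq_matI) auto
  obtain z where z: "z \<in> spectrum ?T" "spectral_radius ?T = norm z"
    using spectral_radius_mem_max(1)[OF T N] by auto
  then obtain v where v: "v \<in> carrier_vec N" "v \<noteq> 0\<^sub>v N" "?T *\<^sub>v v = z \<cdot>\<^sub>v v"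
    using M unfolding spectrum_def eigenvalue_def eigenvector_def by auto
  have "?C *\<^sub>v v = (z / complex_of_real \<omega>) \<cdot>\<^sub>v v"
  proof -
    have "complex_of_real \<omega> \<cdot>\<^sub>v (?C *\<^sub>v v) = z \<cdot>\<^sub>v v"
      using v(3) smult_mat_mult_vec[OF C v(1), of "complex_of_real \<omega>"] by (simp add: T_eq)
    then have "(1 / complex_of_real \<omega>) \<cdot>\<^sub>v (complex_of_real \<omega> \<cdot>\<^sub>v (?C *\<^sub>v v)) = (1 / complex_of_real \<omega>) \<cdot>\<^sub>v (z \<cdot>\<^sub>v v)"
      by simp
    then show ?thesis using \<omega> by (simp add: smult_smult_assoc)
  qed
  then have "z / complex_of_real \<omega> \<in> spectrum ?C"
    using v M unfolding spectrum_def eigenvalue_def eigenvector_def by auto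
  then have "norm (z / complex_of_real \<omega>) \<le> rho M"
    unfolding rho_def by (intro spectral_radius_mem_max(2)[OF C N]) auto
  then have "norm z \<le> \<omega> * rho M"
    using \<omega> by (simp add: norm_divide divide_le_eq mult.commute)
  then have "spectral_radius ?T < 1" using z \<omega> by simp
  then obtain c where c: "norm_bound (?T ^\<^sub>m k) c" for k
    using spectral_radius_jnf_norm_bound_less_1_upper_triangular[OF T] by blast
  \<comment> \<open>The embedding of the reals commutes with powers and preserves moduli, so the
    complex bound descends.\<close>
  have "norm_bound ((\<omega> \<cdot>\<^sub>m M) ^\<^sub>m k) c" for k
  proof -
    have "?T ^\<^sub>m k = map_mat complex_of_real ((\<omega> \<cdot>\<^sub>m M) ^\<^sub>m k)"
      by (rule of_real_hom.mat_hom_pow[symmetric, of _ N]) (use M in auto)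
    then show ?thesis using c[of k] M by (auto simp: norm_bound_def)
  qed
  then show ?thesis by blast
qed

section \<open>The operator and the diagonal matrix on one block\<close>

lemma total_size_eq:
  assumes "dim_row (A 0) = n0"
  shows "total_size d n A = (\<Prod>\<mu>=1..d. n \<mu>) * n0"
proof -
  have "{..d} = insert 0 {1..d}" by auto
  then have "total_size d n A = msize n A 0 * (\<Prod>\<mu>=1..d. msize n A \<mu>)"
    by (simp add: total_size_def)
  then show ?thesis using assms by (simp add: msize_def mult.commute)
qed

lemma sum_list_upt_0: "(\<Sum>\<nu>\<leftarrow>[0..<Suc d]. g \<nu>) = g 0 + (\<Sum>\<nu>=1..d. g \<nu>)" for g :: "nat \<Rightarrow> 'a::comm_monoid_add"
proof -
  have "{0..d} = insert 0 {1..d}" by auto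
  then show ?thesis
    by (simp add: interv_sum_list_conv_sum_set_nat atLeastLessThanSuc_atLeastAtMost del: upt_Suc)
qed

lemma param_op_carrier:
  assumes "\<And>\<mu>. \<mu> \<le> d \<Longrightarrow> A \<mu> \<in> carrier_mat n0 n0"
  shows "param_op d n p A \<in> carrier_mat ((\<Prod>\<mu>=1..d. n \<mu>) * n0) ((\<Prod>\<mu>=1..d. n \<mu>) * n0)"
proof -
  have N: "total_size d n A = (\<Prod>\<mu>=1..d. n \<mu>) * n0"
    using assms[of 0] by (intro total_size_eq) auto
  show ?thesis
    unfolding param_op_def N using assms
    by (intro msum_carrier tensor_carrier) auto
qed

lemma A_param_index:
  assumes "\<And>\<mu>. \<mu> \<le> d \<Longrightarrow> A \<mu> \<in> carrier_mat n0 n0" "r < n0" "s < n0"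
  shows "A_param d A x $$ (r, s) = A 0 $$ (r, s) + (\<Sum>\<nu>=1..d. x \<nu> * A \<nu> $$ (r, s))"
proof -
  have 0: "A 0 \<in> carrier_mat n0 n0" using assms by simp
  have car: "\<nu> \<in> set [1..<Suc d] \<Longrightarrow> x \<nu> \<cdot>\<^sub>m A \<nu> \<in> carrier_mat n0 n0" for \<nu>
    using assms(1)[of \<nu>] by auto
  have M: "msum n0 (\<lambda>\<nu>. x \<nu> \<cdot>\<^sub>m A \<nu>) [1..<Suc d] \<in> carrier_mat n0 n0"
    by (rule msum_carrier) (rule car)
  have "A_param d A x $$ (r, s) = A 0 $$ (r, s) + msum n0 (\<lambda>\<nu>. x \<nu> \<cdot>\<^sub>m A \<nu>) [1..<Suc d] $$ (r, s)"
    using M 0 assms(2,3) by (simp add: A_param_def del: upt_Suc One_nat_def)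
  also have "msum n0 (\<lambda>\<nu>. x \<nu> \<cdot>\<^sub>m A \<nu>) [1..<Suc d] $$ (r, s) = (\<Sum>\<nu>\<leftarrow>[1..<Suc d]. (x \<nu> \<cdot>\<^sub>m A \<nu>) $$ (r, s))"
    using assms(2,3) by (intro msum_index car)
  also have "\<dots> = (\<Sum>\<nu>=1..d. (x \<nu> \<cdot>\<^sub>m A \<nu>) $$ (r, s))"
    by (simp add: interv_sum_list_conv_sum_set_nat atLeastLessThanSuc_atLeastAtMost del: upt_Suc)
  also have "\<dots> = (\<Sum>\<nu>=1..d. x \<nu> * A \<nu> $$ (r, s))"
  proof (rule sum.cong)
    fix \<nu> assume "\<nu> \<in> {1..d}"
    then show "(x \<nu> \<cdot>\<^sub>m A \<nu>) $$ (r, s) = x \<nu> * A \<nu> $$ (r, s)"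
      using assms(1)[of \<nu>] assms(2,3) by simp
  qed simp
  finally show ?thesis .
qed

lemma A_param_carrier:
  assumes "\<And>\<mu>. \<mu> \<le> d \<Longrightarrow> A \<mu> \<in> carrier_mat n0 n0"
  shows "A_param d A x \<in> carrier_mat n0 n0"
proof -
  have 0: "A 0 \<in> carrier_mat n0 n0" using assms by simp
  have "\<nu> \<in> set [1..<Suc d] \<Longrightarrow> x \<nu> \<cdot>\<^sub>m A \<nu> \<in> carrier_mat n0 n0" for \<nu>
    using assms(1)[of \<nu>] by auto
  then have "msum n0 (\<lambda>\<nu>. x \<nu> \<cdot>\<^sub>m A \<nu>) [1..<Suc d] \<in> carrier_mat n0 n0"
    by (rule msum_carrier)
  with 0 show ?thesis
    by (simp add: A_param_def del: upt_Suc One_nat_def)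
qed

text \<open>In summand \<nu> the digits select \<open>p \<nu> (j \<nu>)\<close> from factor \<nu>
  and 1 from each identity, so the summands add up to A(p) inside the block. Outside it every
  summand vanishes, which is the block diagonality.\<close>

lemma param_op_block_row:
  assumes A: "\<And>\<mu>. \<mu> \<le> d \<Longrightarrow> A \<mu> \<in> carrier_mat n0 n0"
    and j: "\<And>\<mu>. \<mu> \<in> {1..d} \<Longrightarrow> j \<mu> < n \<mu>"
    and r: "r < n0" and c: "c < (\<Prod>\<mu>=1..d. n \<mu>) * n0"
  shows "param_op d n p A $$ (block_pos d n j * n0 + r, c) =
    (if c div n0 = block_pos d n j then A_param d A (\<lambda>\<nu>. p \<nu> (j \<nu>)) $$ (r, c mod n0) else 0)"
proof -
  define F where "F \<nu> \<mu> = (if \<mu> = 0 then A \<nu> else if \<mu> = \<nu> then mat_diag (n \<nu>) (p \<nu>) else 1\<^sub>m (n \<mu>))"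
    for \<nu> \<mu>
  let ?q = "block_pos d n j" and ?N = "(\<Prod>\<mu>=1..d. n \<mu>) * n0"
  have N: "total_size d n A = ?N" using A[of 0] by (intro total_size_eq) auto
  have row: "?q * n0 + r < ?N" by (rule block_row_less[OF block_pos_less r]) (rule j)
  have F: "tensor d (F \<nu>) $$ (?q * n0 + r, c) =
      (if c div n0 = ?q then (\<Prod>\<mu>=1..d. (if \<mu> = \<nu> then p \<nu> (j \<nu>) else 1)) * A \<nu> $$ (r, c mod n0) else 0)"
    if "\<nu> \<le> d" for \<nu>
  proof -
    have F0: "F \<nu> 0 = A \<nu>" by (simp add: F_def)
    have "tensor d (F \<nu>) $$ (?q * n0 + r, c) =
      (if c div n0 = ?q then (\<Prod>\<mu>=1..d. (if \<mu> = \<nu> then p \<nu> else (\<lambda>_. 1)) (j \<mu>)) * F \<nu> 0 $$ (r, c mod n0) else 0)"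
      by (rule tensor_block_row) (use A that r c j in \<open>auto simp: F_def\<close>)
    also have "(\<Prod>\<mu>=1..d. (if \<mu> = \<nu> then p \<nu> else (\<lambda>_. 1)) (j \<mu>)) = (\<Prod>\<mu>=1..d. (if \<mu> = \<nu> then p \<nu> (j \<nu>) else 1))"
      by (intro prod.cong) auto
    finally show ?thesis unfolding F0 .
  qed
  have car: "tensor d (F \<nu>) \<in> carrier_mat ?N ?N" if "\<nu> \<in> set [0..<Suc d]" for \<nu>
    using A that by (intro tensor_carrier) (auto simp: F_def)
  have "param_op d n p A $$ (?q * n0 + r, c) = (\<Sum>\<nu>\<leftarrow>[0..<Suc d]. tensor d (F \<nu>) $$ (?q * n0 + r, c))"
    unfolding param_op_def N F_def[symmetric] by (rule msum_index[OF car row c])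
  also have "\<dots> = tensor d (F 0) $$ (?q * n0 + r, c) + (\<Sum>\<nu>=1..d. tensor d (F \<nu>) $$ (?q * n0 + r, c))"
    by (rule sum_list_upt_0)
  \<comment> \<open>For \<nu> = 0 no index in {1..d} equals \<nu>, so the product is 1.\<close>
  also have "\<dots> = (if c div n0 = ?q then A 0 $$ (r, c mod n0) else 0)
     + (\<Sum>\<nu>=1..d. if c div n0 = ?q then p \<nu> (j \<nu>) * A \<nu> $$ (r, c mod n0) else 0)"
    by (intro arg_cong2[of _ _ _ _ "(+)"] sum.cong) (auto simp: F prod.delta)
  also have "\<dots> = (if c div n0 = ?q then A_param d A (\<lambda>\<nu>. p \<nu> (j \<nu>)) $$ (r, c mod n0) else 0)"
    using A r by (simp add: A_param_index[of d A n0])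
  finally show ?thesis .
qed

lemma D_tilde_mat_diag:
  assumes "dim_row (A 0) = n0"
  shows "\<exists>f. D_tilde d n p A = mat_diag ((\<Prod>\<mu>=1..d. n \<mu>) * n0) f"
proof -
  have "\<exists>f. tensor d (\<lambda>\<mu>. if \<mu> = \<nu> then c_max A \<nu> \<cdot>\<^sub>m D_mat n p A \<nu> else 1\<^sub>m (msize n A \<mu>))
      = mat_diag (total_size d n A) f" for \<nu>
    unfolding total_size_def
  proof (rule tensor_mat_diag)
    fix \<mu>
    show "\<exists>f. (if \<mu> = \<nu> then c_max A \<nu> \<cdot>\<^sub>m D_mat n p A \<nu> else 1\<^sub>m (msize n A \<mu>)) = mat_diag (msize n A \<mu>) f"
      by (auto simp: D_mat_def msize_def diag_part_def smult_mat_diag simp flip: mat_diag_one)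
  qed
  then obtain f where "tensor d (\<lambda>\<mu>. if \<mu> = \<nu> then c_max A \<nu> \<cdot>\<^sub>m D_mat n p A \<nu> else 1\<^sub>m (msize n A \<mu>))
      = mat_diag (total_size d n A) (f \<nu>)" for \<nu> by metis
  then have "D_tilde d n p A = mat_diag (total_size d n A) (\<lambda>i. \<Sum>\<nu>\<leftarrow>[0..<Suc d]. f \<nu> i)"
    unfolding D_tilde_def by (rule msum_mat_diag)
  then show ?thesis using total_size_eq[of A, OF assms] by auto
qed

text \<open>Summand 0 contributes the diagonal of \<open>A 0\<close>, as c_0 = 1; every other
  summand has the identity as factor 0 and is therefore constant along the block's diagonal.\<close>

lemma D_tilde_block_entry:
  assumes A: "A 0 \<in> carrier_mat n0 n0"
    and j: "\<And>\<mu>. \<mu> \<in> {1..d} \<Longrightarrow> j \<mu> < n \<mu>" and r: "r < n0"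
  shows "D_tilde d n p A $$ (block_pos d n j * n0 + r, block_pos d n j * n0 + r) =
    A 0 $$ (r, r) + (\<Sum>\<nu>=1..d. c_max A \<nu> * p \<nu> (j \<nu>))"
proof -
  define F where "F \<nu> \<mu> = (if \<mu> = \<nu> then c_max A \<nu> \<cdot>\<^sub>m D_mat n p A \<nu> else 1\<^sub>m (msize n A \<mu>))"
    for \<nu> \<mu>
  let ?q = "block_pos d n j" and ?N = "(\<Prod>\<mu>=1..d. n \<mu>) * n0"
  have N: "total_size d n A = ?N" using A by (intro total_size_eq) auto
  have row: "?q * n0 + r < ?N" by (rule block_row_less[OF block_pos_less r]) (rule j)
  have F0: "F \<nu> 0 \<in> carrier_mat n0 n0" for \<nu>
    using A by (auto simp: F_def D_mat_def diag_part_def msize_def)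
  have F1: "F \<nu> \<mu> = mat_diag (n \<mu>) (if \<mu> = \<nu> then (\<lambda>i. c_max A \<nu> * p \<nu> i) else (\<lambda>_. 1))"
    if "\<mu> \<in> {1..d}" for \<nu> \<mu>
    using that by (auto simp: F_def D_mat_def msize_def smult_mat_diag)
  have F: "tensor d (F \<nu>) $$ (?q * n0 + r, ?q * n0 + r) =
      (\<Prod>\<mu>=1..d. (if \<mu> = \<nu> then c_max A \<nu> * p \<nu> (j \<nu>) else 1)) * F \<nu> 0 $$ (r, r)" for \<nu>
  proof -
    have "tensor d (F \<nu>) $$ (?q * n0 + r, ?q * n0 + r) =
      (\<Prod>\<mu>=1..d. (if \<mu> = \<nu> then (\<lambda>i. c_max A \<nu> * p \<nu> i) else (\<lambda>_. 1)) (j \<mu>)) * F \<nu> 0 $$ (r, r)"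
      using tensor_block_row[OF F0 F1 j r row] r by simp
    also have "(\<Prod>\<mu>=1..d. (if \<mu> = \<nu> then (\<lambda>i. c_max A \<nu> * p \<nu> i) else (\<lambda>_. 1)) (j \<mu>))
      = (\<Prod>\<mu>=1..d. (if \<mu> = \<nu> then c_max A \<nu> * p \<nu> (j \<nu>) else 1))"
      by (intro prod.cong) auto
    finally show ?thesis .
  qed
  have car: "tensor d (F \<nu>) \<in> carrier_mat ?N ?N" for \<nu>
    using F0 F1 by (intro tensor_carrier) auto
  have "D_tilde d n p A $$ (?q * n0 + r, ?q * n0 + r) = (\<Sum>\<nu>\<leftarrow>[0..<Suc d]. tensor d (F \<nu>) $$ (?q * n0 + r, ?q * n0 + r))"
    unfolding D_tilde_def N F_def[symmetric] by (rule msum_index[OF car row row])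
  also have "\<dots> = tensor d (F 0) $$ (?q * n0 + r, ?q * n0 + r) + (\<Sum>\<nu>=1..d. tensor d (F \<nu>) $$ (?q * n0 + r, ?q * n0 + r))"
    by (rule sum_list_upt_0)
  also have "\<dots> = A 0 $$ (r, r) + (\<Sum>\<nu>=1..d. c_max A \<nu> * p \<nu> (j \<nu>))"
    using A r unfolding F
    by (intro arg_cong2[of _ _ _ _ "(+)"] sum.cong)
      (auto simp: prod.delta F_def D_mat_def c_max_def diag_part_def smult_mat_diag mat_diag_index msize_def)
  finally show ?thesis .
qed

section \<open>Lower bounds for exponential sums and for the norm\<close>

lemma exp_sum_pos:
  assumes "1 \<le> k" "positive_weights k \<alpha> \<beta>"
  shows "0 < exp_sum k \<alpha> \<beta> x"
  using assms unfolding exp_sum_def positive_weights_def by (intro sum_pos) auto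

lemma exp_sum_antimono:
  assumes "positive_weights k \<alpha> \<beta>" "x \<le> y"
  shows "exp_sum k \<alpha> \<beta> y \<le> exp_sum k \<alpha> \<beta> x"
  unfolding exp_sum_def
proof (rule sum_mono)
  fix m assume "m \<in> {1..k}"
  then have "0 < \<alpha> m" "0 < \<beta> m" using assms(1) by (auto simp: positive_weights_def)
  then show "\<alpha> m * exp (- \<beta> m * y) \<le> \<alpha> m * exp (- \<beta> m * x)"
    using assms(2) by simp
qed

lemma nonneg_entriesD:
  "nonneg_entries M \<Longrightarrow> i < dim_row M \<Longrightarrow> j < dim_col M \<Longrightarrow> 0 \<le> M $$ (i, j)"
  by (simp add: nonneg_entries_def)

text \<open>Each maximum \<open>c_max A \<nu>\<close> is attained at some i, and nonnegativity of
  the other terms gives x \<nu> * A \<nu>[i,i] \<le> A(x)[i,i], which is at most the norm. As i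
  varies with \<nu>, the d + 1 terms are bounded separately, whence the factor.\<close>

lemma D_tilde_entry_le_norm:
  assumes A: "\<And>\<mu>. \<mu> \<le> d \<Longrightarrow> A \<mu> \<in> carrier_mat n0 n0" and n0: "1 \<le> n0"
    and diag: "\<And>\<mu> i. \<mu> \<le> d \<Longrightarrow> i < n0 \<Longrightarrow> 0 \<le> A \<mu> $$ (i, i)"
    and x: "\<And>\<nu>. \<nu> \<in> {1..d} \<Longrightarrow> 0 \<le> x \<nu>"
  shows "A 0 $$ (0, 0) + (\<Sum>\<nu>=1..d. c_max A \<nu> * x \<nu>) \<le> (real d + 1) * norm2_mat (A_param d A x)"
proof -
  let ?V = "norm2_mat (A_param d A x)"
  have entry: "A 0 $$ (i, i) + (\<Sum>\<nu>=1..d. x \<nu> * A \<nu> $$ (i, i)) \<le> ?V" if i: "i < n0" for i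
    using diag_entry_le_norm2_mat[OF A_param_carrier[where x = x, OF A] i] A_param_index[where x = x, OF A i i] by simp
  have nonneg: "0 \<le> x \<nu> * A \<nu> $$ (i, i)" if "\<nu> \<in> {1..d}" "i < n0" for \<nu> i
    using that x diag by auto
  have "c_max A \<nu> * x \<nu> \<le> ?V" if \<nu>: "\<nu> \<in> {1..d}" for \<nu>
  proof -
    have "dim_row (A \<nu>) = n0" using A[of \<nu>] \<nu> by auto
    then have "c_max A \<nu> \<in> (\<lambda>i. A \<nu> $$ (i, i)) ` {..<n0}"
      unfolding c_max_def using n0 \<nu> by (simp, intro Max_in) (auto simp: lessThan_empty_iff)
    then obtain i where i: "i < n0" "c_max A \<nu> = A \<nu> $$ (i, i)" by auto
    have "x \<nu> * A \<nu> $$ (i, i) \<le> (\<Sum>\<nu>=1..d. x \<nu> * A \<nu> $$ (i, i))"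
      using \<nu> i nonneg by (intro member_le_sum) auto
    also have "\<dots> \<le> ?V" using entry[OF i(1)] diag[of 0 i] i(1) by simp
    finally show ?thesis by (simp add: i(2) mult.commute)
  qed
  then have "(\<Sum>\<nu>=1..d. c_max A \<nu> * x \<nu>) \<le> (\<Sum>\<nu>=1..d. ?V)" by (rule sum_mono)
  moreover have "A 0 $$ (0, 0) \<le> ?V"
    using entry[of 0] n0 sum_nonneg[of "{1..d}" "\<lambda>\<nu>. x \<nu> * A \<nu> $$ (0, 0)"] nonneg by fastforce
  ultimately show ?thesis by (simp add: algebra_simps)
qed

lemma mod_jac_diag_block:
  assumes E: "E \<in> carrier_mat (P * l) (P * l)" "row_in_block l q E"
    and A: "A \<in> carrier_mat (P * l) (P * l)" and q: "q < P"
  shows "diag_block l q (mod_jac \<omega> E A) = 1\<^sub>m l - \<omega> \<cdot>\<^sub>m (diag_block l q E * diag_block l q A)"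
proof -
  have "diag_block l q (mod_jac \<omega> E A) = diag_block l q (1\<^sub>m (P * l)) - \<omega> \<cdot>\<^sub>m diag_block l q (E * A)"
    using E A block_row_less[OF q] unfolding mod_jac_def
    by (intro eq_matI) (auto simp: diag_block_def)
  then show ?thesis
    by (simp add: diag_block_one[OF q] diag_block_mult[OF E A q])
qed

lemma diag_block_smult:
  assumes "M \<in> carrier_mat (P * l) (P * l)" "q < P"
  shows "diag_block l q (c \<cdot>\<^sub>m M) = c \<cdot>\<^sub>m diag_block l q M"
  using assms block_row_less[OF assms(2)] by (intro eq_matI) (auto simp: diag_block_def)

text \<open>The spectral radius bounds the powers of the full matrix, and the entries of a block of
  a power are among its entries. So the powers of the block are bounded without comparing spectral
  radii of blocks.\<close>

lemma block_smoothing: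
  fixes A :: "real mat"
  assumes E: "E = mat_diag (P * l) e" and q: "q < P" and l: "1 \<le> l"
    and op: "\<A> \<in> carrier_mat (P * l) (P * l)" "row_in_block l q \<A>" and A: "diag_block l q \<A> = A"
    and spd: "spd A"
    and e: "\<And>r. r < l \<Longrightarrow> \<epsilon> \<le> e (q * l + r)" "0 < \<epsilon>"
    and \<omega>: "0 < \<omega>" "\<omega> < 1 / rho (E * \<A>)"
  shows "norm2_mat (A * diag_block l q (mod_jac \<omega> E \<A>) ^\<^sub>m \<nu>) \<le> 1 / (\<omega> * \<epsilon> * sqrt (real (Suc \<nu>)))"
proof -
  have Ec: "E \<in> carrier_mat (P * l) (P * l)" "row_in_block l q E"
    using q by (auto simp: E row_in_block_mat_diag)
  have EA: "E * \<A> \<in> carrier_mat (P * l) (P * l)" using Ec op by simp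
  have T: "\<omega> \<cdot>\<^sub>m (E * \<A>) \<in> carrier_mat (P * l) (P * l)" using EA by simp
  have rowT: "row_in_block l q (\<omega> \<cdot>\<^sub>m (E * \<A>))"
    using row_in_block_mult[OF Ec op q] EA block_row_less[OF q] by (auto simp: row_in_block_def)
  have Ac: "A \<in> carrier_mat l l" using A by auto
  let ?e = "\<lambda>r. e (q * l + r)"
  have blockE: "diag_block l q E = mat_diag l ?e" by (simp add: E diag_block_mat_diag[OF q])
  have blockT: "diag_block l q (\<omega> \<cdot>\<^sub>m (E * \<A>)) = \<omega> \<cdot>\<^sub>m (mat_diag l ?e * A)"
    by (simp add: diag_block_smult[OF EA q] diag_block_mult[OF Ec op(1) q] A blockE)
  \<comment> \<open>As 1 / 0 = 0, a positive \<omega> below 1 / rho excludes rho = 0 too.\<close>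
  have "0 < rho (E * \<A>)" using \<omega> by (smt (verit) zero_less_divide_1_iff)
  then have "\<omega> * rho (E * \<A>) < 1" using \<omega> by (simp add: field_simps)
  then obtain c where c: "norm_bound ((\<omega> \<cdot>\<^sub>m (E * \<A>)) ^\<^sub>m k) c" for k
    using spectral_radius_power_bound[OF EA _ \<omega>(1)] q l by auto
  have bound: "norm_bound ((\<omega> \<cdot>\<^sub>m (mat_diag l ?e * A)) ^\<^sub>m k) c" for k
    using norm_bound_diag_block[OF pow_carrier_mat[OF T] c q, of k] diag_block_pow[OF T rowT q, of k]
    by (simp add: blockT)
  have psd: "0 \<le> x \<bullet> (A *\<^sub>v x)" if "x \<in> carrier_vec l" for x
  proof (cases "x = 0\<^sub>v l")
    case True then show ?thesis using Ac by simp
  next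
    case False then show ?thesis using spd that Ac unfolding spd_def by (auto intro: less_imp_le)
  qed
  show ?thesis
    unfolding mod_jac_diag_block[OF Ec op(1) q] A blockE
    using spd by (intro jacobi_smoothing[OF Ac _ psd e \<omega>(1) bound]) (auto simp: spd_def)
qed

section \<open>Uniformity in level and parameter\<close>

lemma multi_indices_less: "j \<in> multi_indices d n \<Longrightarrow> \<mu> \<in> {1..d} \<Longrightarrow> j \<mu> < n \<mu>"
  by (auto simp: multi_indices_def)

theorem theorem4p18:
  fixes h :: "nat \<Rightarrow> real"
    and d k :: nat
    and n n0 :: "nat \<Rightarrow> nat"
    and p :: "nat \<Rightarrow> nat \<Rightarrow> real"
    and A :: "nat \<Rightarrow> nat \<Rightarrow> real mat"
    and a \<omega> :: real
    and b :: ereal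
    and \<alpha> \<beta> :: "nat \<Rightarrow> real"
  assumes grid: "\<And>l. 0 < h l"
    and d: "1 \<le> d"
    and n: "\<And>\<nu>. \<nu> \<in> {1..d} \<Longrightarrow> 1 \<le> n \<nu>"
    and n0: "\<And>l. 1 \<le> n0 l"
    and A: "\<And>l \<mu>. \<mu> \<le> d \<Longrightarrow> A l \<mu> \<in> carrier_mat (n0 l) (n0 l)"
    and spd: "\<And>l j. j \<in> multi_indices d n \<Longrightarrow> spd (A_param d (A l) (\<lambda>\<nu>. p \<nu> (j \<nu>)))"
    and diag_nonneg: "\<And>l \<mu>. \<mu> \<le> d \<Longrightarrow> nonneg_entries (diag_part (A l \<mu>))"
    and D_nonneg: "\<And>l \<mu>. \<mu> \<le> d \<Longrightarrow> nonneg_entries (D_mat n p (A l) \<mu>)"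
    and ab: "0 < a" "ereal a < b"
    and spectrum: "\<And>l. cspectrum (D_tilde d n p (A l)) \<subseteq> complex_of_real ` ivl a b"
    and level_uniform: "b = \<infinity> \<Longrightarrow>
          \<exists>B::real. \<forall>l. cspectrum (D_tilde d n p (A l)) \<subseteq> complex_of_real ` ivl a (ereal B)"
    and k: "1 \<le> k"
    and weights: "best_weights (b / ereal a) k \<alpha> \<beta>"
    and omega: "0 < \<omega>"
      "\<And>l. \<omega> < 1 / rho (E_star a k \<alpha> \<beta> (D_tilde d n p (A l)) * param_op d n p (A l))"
  shows "smoothing_property h (multi_indices d n)
           (\<lambda>l j. A_param d (A l) (\<lambda>\<nu>. p \<nu> (j \<nu>)))
           (\<lambda>l j. block d n (n0 l)
              (mod_jac \<omega> (E_star a k \<alpha> \<beta> (D_tilde d n p (A l))) (param_op d n p (A l))) j)"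
proof -
  \<comment> \<open>The exponential sum tends to 0 at infinity, so a positive lower bound for all
    levels calls for a finite common B. For finite b it is b itself.\<close>
  obtain B :: real where B: "cspectrum (D_tilde d n p (A l)) \<subseteq> complex_of_real ` ivl a (ereal B)" for l
  proof (cases b)
    case (real B)
    then show ?thesis using spectrum that by auto
  next
    case PInf
    then show ?thesis using level_uniform that by auto
  qed (use ab in auto)
  let ?\<alpha> = "\<lambda>m. \<alpha> m / a" and ?\<beta> = "\<lambda>m. \<beta> m / a"
  let ?A = "\<lambda>l j. A_param d (A l) (\<lambda>\<nu>. p \<nu> (j \<nu>))"
  let ?S = "\<lambda>l. mod_jac \<omega> (E_star a k \<alpha> \<beta> (D_tilde d n p (A l))) (param_op d n p (A l))"
  have pos: "positive_weights k ?\<alpha> ?\<beta>"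
    using weights ab(1) by (auto simp: best_weights_def positive_weights_def)
  \<comment> \<open>The exponential sum does not increase, so on [a, B] it is smallest at B.\<close>
  define \<epsilon> where "\<epsilon> = exp_sum k ?\<alpha> ?\<beta> B"
  have \<epsilon>: "0 < \<epsilon>" unfolding \<epsilon>_def using k pos by (rule exp_sum_pos)
  define P where "P = (\<Prod>\<mu>=1..d. n \<mu>)"
  \<comment> \<open>The block estimate supplies 1 / (\<omega> * \<epsilon> * sqrt (\<nu> + 1)). The
    factor (d + 1) / a comes from a \<le> (d + 1) |A(p)|, which makes the estimate relative to the
    norm. No constant depends on the level.\<close>
  define \<eta> where "\<eta> \<nu> = (real d + 1) / (a * \<omega> * \<epsilon>) / sqrt (real (Suc \<nu>))" for \<nu>
  have main: "norm2_mat (?A l j * block d n (n0 l) (?S l) j ^\<^sub>m \<nu>) \<le> \<eta> \<nu> * norm2_mat (?A l j)"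
    if j: "j \<in> multi_indices d n" for l j \<nu>
  proof -
    note jn = multi_indices_less[OF j]
    define q where "q = block_pos d n j"
    have q: "q < P" unfolding q_def P_def using jn by (rule block_pos_less)
    obtain f where f: "D_tilde d n p (A l) = mat_diag (P * n0 l) f"
      using D_tilde_mat_diag[of "A l" "n0 l" d n p] A[of 0 l] unfolding P_def by auto
    have f_ivl: "a \<le> f (q * n0 l + r) \<and> f (q * n0 l + r) \<le> B" if "r < n0 l" for r
    proof -
      have "complex_of_real (f (q * n0 l + r)) \<in> complex_of_real ` ivl a (ereal B)"
        using B[of l] mat_diag_entry_in_cspectrum[OF block_row_less[OF q that], of f] unfolding f by blast
      then show ?thesis by (auto simp: ivl_def)
    qed
    \<comment> \<open>One diagonal entry per block suffices for the norm bound; the first exists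
      because the block is nonempty.\<close>
    have "f (q * n0 l) = D_tilde d n p (A l) $$ (q * n0 l + 0, q * n0 l + 0)"
      using block_row_less[OF q, of 0 "n0 l"] n0[of l] by (simp add: f mat_diag_index)
    also have "\<dots> = A l 0 $$ (0, 0) + (\<Sum>\<nu>=1..d. c_max (A l) \<nu> * p \<nu> (j \<nu>))"
      unfolding q_def using A[of 0 l] n0[of l] jn by (intro D_tilde_block_entry) auto
    also have "\<dots> \<le> (real d + 1) * norm2_mat (?A l j)"
    proof (rule D_tilde_entry_le_norm[OF A n0])
      show "0 \<le> A l \<mu> $$ (i, i)" if "\<mu> \<le> d" "i < n0 l" for \<mu> i
        using nonneg_entriesD[OF diag_nonneg[OF that(1), of l], of i i] A[OF that(1), of l] that(2)
        by (simp add: diag_part_def mat_diag_def)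
      show "0 \<le> p \<nu> (j \<nu>)" if "\<nu> \<in> {1..d}" for \<nu>
        using nonneg_entriesD[OF D_nonneg[of \<nu> l], of "j \<nu>" "j \<nu>"] jn[OF that] that
        by (simp add: D_mat_def mat_diag_def)
    qed
    finally have norm: "a \<le> (real d + 1) * norm2_mat (?A l j)"
      using f_ivl[of 0] n0[of l] by simp
    have op: "param_op d n p (A l) \<in> carrier_mat (P * n0 l) (P * n0 l)"
      unfolding P_def using A by (rule param_op_carrier)
    have row: "param_op d n p (A l) $$ (q * n0 l + r, c) = (if c div n0 l = q then ?A l j $$ (r, c mod n0 l) else 0)"
      if "r < n0 l" "c < P * n0 l" for r c
      unfolding q_def using A jn that unfolding P_def by (rule param_op_block_row)
    have Ap: "?A l j \<in> carrier_mat (n0 l) (n0 l)" using A by (rule A_param_carrier)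
    have "norm2_mat (?A l j * diag_block (n0 l) q (?S l) ^\<^sub>m \<nu>) \<le> 1 / (\<omega> * \<epsilon> * sqrt (real (Suc \<nu>)))"
    proof (rule block_smoothing[OF _ q n0 op _ _ spd[OF j]])
      show "E_star a k \<alpha> \<beta> (D_tilde d n p (A l)) = mat_diag (P * n0 l) (\<lambda>i. exp_sum k ?\<alpha> ?\<beta> (f i))"
        unfolding f by (rule E_star_mat_diag)
      show "row_in_block (n0 l) q (param_op d n p (A l))"
        using row op by (auto simp: row_in_block_def)
      show "diag_block (n0 l) q (param_op d n p (A l)) = ?A l j"
        using Ap block_row_less[OF q, of _ "n0 l"]
        by (intro eq_matI) (auto simp: diag_block_def row)
      show "\<epsilon> \<le> exp_sum k ?\<alpha> ?\<beta> (f (q * n0 l + r))" if "r < n0 l" for r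
        unfolding \<epsilon>_def using f_ivl[OF that] by (intro exp_sum_antimono pos) simp
    qed (use omega \<epsilon> in auto)
    also have "\<dots> \<le> ((real d + 1) * norm2_mat (?A l j)) / a * (1 / (\<omega> * \<epsilon> * sqrt (real (Suc \<nu>))))"
      using norm ab(1) omega(1) \<epsilon> mult_right_mono[of 1 "((real d + 1) * norm2_mat (?A l j)) / a" "1 / (\<omega> * \<epsilon> * sqrt (real (Suc \<nu>)))"]
      by simp
    also have "\<dots> = \<eta> \<nu> * norm2_mat (?A l j)"
      by (simp add: \<eta>_def)
    finally show ?thesis by (simp add: block_eq_diag_block q_def)
  qed
  have "(\<lambda>\<nu>. 1 / sqrt (real (Suc \<nu>))) \<longlonglongrightarrow> 0"
    by (intro tendsto_divide_0[OF tendsto_const] filterlim_at_top_imp_at_infinity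
        filterlim_compose[OF sqrt_at_top] filterlim_compose[OF filterlim_real_sequentially filterlim_Suc])
  then have "\<eta> \<longlonglongrightarrow> 0"
    using tendsto_mult_right_zero[of "\<lambda>\<nu>. 1 / sqrt (real (Suc \<nu>))" sequentially "(real d + 1) / (a * \<omega> * \<epsilon>)"]
    unfolding \<eta>_def by simp
  \<comment> \<open>The estimate holds for every number of steps, so the constant \<infinity> serves
    as the step limit.\<close>
  then show ?thesis
    unfolding smoothing_property_def using main
    by (intro exI[of _ \<eta>] exI[of _ "\<lambda>_. \<infinity>"]) auto
qed

end
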